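(* There is an algorithm which, given $n\ge1$, real numbers $x_1\le\cdots\le x_n$, real numbers $Y_1,\dots,Y_n$ and the critical value $\kappa=\kappa(n,\alpha)$ for some $\alpha\in(0,1)$, computes the vector $(\hat U(x_i))_{i=1}^n$ of values of the upper confidence bound $$\hat U:=\sup\bigl\{g:\mathbb{R}\to[-\infty,\infty]\text{ convex}: T_o(\underline{\mathrm{sign}}(g(\mathbf{x})-\mathbf{Y}))\le\kappa\bigr\}$$ (pointwise supremum) in $O(n^4)$ steps.
   Context: Here $\mathbf{x}=(x_i)_{i=1}^n$, $\mathbf{Y}=(Y_i)_{i=1}^n$, $g(\mathbf{x}):=(g(x_i))_{i=1}^n$. A function $g:\mathbb{R}\to[-\infty,\infty]$ is convex if its epigraph $\{(x,y)\in\mathbb{R}^2:g(x)\le y\}$ is convex. Steps are counted in the real-number (real RAM) model: each arithmetic operation, comparison, square root or logarithm of real numbers counts as one step; values $\pm\infty$ are allowed. Sign function: $\underline{\mathrm{sign}}(x):=1\{x>0\}-1\{x\le0\}$ for $x\in[-\infty,\infty]$, applied component-wise to vectors. Test statistic: let $\psi(x):=\max(1-|x|,0)$, $\Gamma(u):=(2\log(e/u))^{1/2}$, $\beta_d:=\bigl(\sum_{i=1-d}^{d-1}\psi(i/d)^2\bigr)^{-1/2}$, and for $\boldsymbol{\sigma}\in\{-1,1\}^n$ $$T_{d,j}(\boldsymbol{\sigma}):=\beta_d\sum_{i=1}^n\psi\Bigl(\frac{i-j}{d}\Bigr)\sigma_i,\qquad T_o(\boldsymbol{\sigma}):=\max_{d=1,\dots,\lfloor(n+1)/2\rfloor}\Bigl(\max_{j=1,\dots,n}T_{d,j}(\boldsymbol{\sigma})-\Gamma\Bigl(\frac{2d-1}{n}\Bigr)\Bigr).$$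 Let $T(\mathbf{v}):=\max\{T_o(\underline{\mathrm{sign}}(\mathbf{v})),T_o(\underline{\mathrm{sign}}(-\mathbf{v}))\}$ for $\mathbf{v}\in[-\infty,\infty]^n$; $\kappa(n,\alpha)$ is the smallest $(1-\alpha)$-quantile of $T(\boldsymbol{\xi})$, where $\boldsymbol{\xi}$ is uniformly distributed on $\{-1,1\}^n$. *)

theory Defs
  imports "HOL-Probability.Probability" "HOL-Library.Landau_Symbols"
begin

section \<open>The test statistic\<close>

text \<open>
  Vectors with entries indexed by \<open>1,\<dots>,n\<close> are functions on \<^typ>\<open>nat\<close>;
  only their values on \<open>{1..n}\<close> matter.
\<close>

definition sgn_low :: "ereal \<Rightarrow> real" where
  "sgn_low v = (if v > 0 then 1 else 0) - (if v \<le> 0 then 1 else 0)"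

definition psi :: "real \<Rightarrow> real" where
  "psi t = max (1 - \<bar>t\<bar>) 0"

definition Gam :: "real \<Rightarrow> real" where
  "Gam u = (2 * ln (exp 1 / u)) powr (1 / 2)"

definition beta_scale :: "nat \<Rightarrow> real" where
  "beta_scale d =
     (\<Sum>i = 1 - int d..int d - 1. (psi (real_of_int i / real d))\<^sup>2) powr (- 1 / 2)"

definition T_loc :: "nat \<Rightarrow> nat \<Rightarrow> nat \<Rightarrow> (nat \<Rightarrow> real) \<Rightarrow> real" where
  "T_loc n d j \<sigma> =
     beta_scale d * (\<Sum>i = 1..n. psi ((real i - real j) / real d) * \<sigma> i)"

definition T_o :: "nat \<Rightarrow> (nat \<Rightarrow> real) \<Rightarrow> real" where
  "T_o n \<sigma> =
     (MAX d\<in>{1..(n + 1) div 2}. (MAX j\<in>{1..n}. T_loc n d j \<sigma>) - Gam ((2 * real d - 1) / real n))"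

definition T_stat :: "nat \<Rightarrow> (nat \<Rightarrow> ereal) \<Rightarrow> real" where
  "T_stat n v = max (T_o n (\<lambda>i. sgn_low (v i))) (T_o n (\<lambda>i. sgn_low (- v i)))"


section \<open>The critical value\<close>

definition is_quantile :: "'a pmf \<Rightarrow> ('a \<Rightarrow> real) \<Rightarrow> real \<Rightarrow> real \<Rightarrow> bool" where
  "is_quantile M X p r \<longleftrightarrow>
     measure_pmf.prob M {\<omega>. X \<omega> \<le> r} \<ge> p \<and> measure_pmf.prob M {\<omega>. X \<omega> \<ge> r} \<ge> 1 - p"

definition sign_vectors :: "nat \<Rightarrow> (nat \<Rightarrow> real) set" where
  "sign_vectors n = {1..n} \<rightarrow>\<^sub>E {- 1, 1}"

definition kappa :: "nat \<Rightarrow> real \<Rightarrow> real" where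
  "kappa n \<alpha> =
     (LEAST r. is_quantile (pmf_of_set (sign_vectors n)) (\<lambda>\<xi>. T_stat n (\<lambda>i. ereal (\<xi> i))) (1 - \<alpha>) r)"


section \<open>The upper confidence bound\<close>

definition convex_fun :: "(real \<Rightarrow> ereal) \<Rightarrow> bool" where
  "convex_fun g \<longleftrightarrow> convex {(x, y). g x \<le> ereal y}"

definition U_hat :: "nat \<Rightarrow> (nat \<Rightarrow> real) \<Rightarrow> (nat \<Rightarrow> real) \<Rightarrow> real \<Rightarrow> real \<Rightarrow> ereal" where
  "U_hat n x Y k t =
     (SUP g\<in>{g. convex_fun g \<and> T_o n (\<lambda>i. sgn_low (g (x i) - ereal (Y i))) \<le> k}. g t)"


section \<open>The real RAM\<close>

text \<open>
  A real RAM has index registers holding natural numbers and arrays of cells holding extended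
  reals.  It is programmed in a while language; a program is a finite object and does not depend
  on the input.  The only constants are integers.  Index arithmetic is restricted to addition and
  (truncated) subtraction, and extended reals cannot be converted to indices (no rounding).
\<close>

datatype iexp =
    INum nat
  | IReg string
  | IAdd iexp iexp
  | ISub iexp iexp

datatype rexp =
    RNum int
  | RCell string iexp
  | ROfIdx iexp
  | RAdd rexp rexp
  | RSub rexp rexp
  | RMul rexp rexp
  | RDiv rexp rexp
  | RSqrt rexp
  | RLn rexp

datatype bexp =
    ILess iexp iexp
  | RLess rexp rexp
  | BNot bexp
  | BAnd bexp bexp

datatype com =
    Skip
  | IAssign string iexp
  | RAssign string iexp rexp
  | Seq com com
  | Cond bexp com com
  | While bexp com

record ram =
  reg :: "string \<Rightarrow> nat"
  cell :: "string \<Rightarrow> nat \<Rightarrow> ereal"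

text \<open>
  Arithmetic involving \<open>\<plusminus>\<infinity>\<close> or division by zero follows the library conventions for
  \<^typ>\<open>ereal\<close>, so every operation is total.  Square root and logarithm are extended
  continuously to \<open>[0, \<infinity>]\<close> and by constants to negative arguments.
\<close>

definition ext_sqrt :: "ereal \<Rightarrow> ereal" where
  "ext_sqrt v = (if v = \<infinity> then \<infinity> else if v \<le> 0 then 0 else ereal (sqrt (real_of_ereal v)))"

definition ext_ln :: "ereal \<Rightarrow> ereal" where
  "ext_ln v = (if v = \<infinity> then \<infinity> else if v \<le> 0 then - \<infinity> else ereal (ln (real_of_ereal v)))"

primrec ival :: "iexp \<Rightarrow> ram \<Rightarrow> nat" where
  "ival (INum k) s = k"
| "ival (IReg v) s = reg s v"
| "ival (IAdd a b) s = ival a s + ival b s"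
| "ival (ISub a b) s = ival a s - ival b s"

primrec rval :: "rexp \<Rightarrow> ram \<Rightarrow> ereal" where
  "rval (RNum k) s = ereal (real_of_int k)"
| "rval (RCell a i) s = cell s a (ival i s)"
| "rval (ROfIdx i) s = ereal (real (ival i s))"
| "rval (RAdd a b) s = rval a s + rval b s"
| "rval (RSub a b) s = rval a s - rval b s"
| "rval (RMul a b) s = rval a s * rval b s"
| "rval (RDiv a b) s = rval a s / rval b s"
| "rval (RSqrt a) s = ext_sqrt (rval a s)"
| "rval (RLn a) s = ext_ln (rval a s)"

primrec bval :: "bexp \<Rightarrow> ram \<Rightarrow> bool" where
  "bval (ILess a b) s \<longleftrightarrow> ival a s < ival b s"
| "bval (RLess a b) s \<longleftrightarrow> rval a s < rval b s"
| "bval (BNot b) s \<longleftrightarrow> \<not> bval b s"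
| "bval (BAnd a b) s \<longleftrightarrow> bval a s \<and> bval b s"

text \<open>
  Every node of an expression costs one step, so reading constants, registers and cells,
  index arithmetic and Boolean connectives are charged as well.
\<close>

primrec icost :: "iexp \<Rightarrow> nat" where
  "icost (INum k) = 1"
| "icost (IReg v) = 1"
| "icost (IAdd a b) = 1 + icost a + icost b"
| "icost (ISub a b) = 1 + icost a + icost b"

primrec rcost :: "rexp \<Rightarrow> nat" where
  "rcost (RNum k) = 1"
| "rcost (RCell a i) = 1 + icost i"
| "rcost (ROfIdx i) = 1 + icost i"
| "rcost (RAdd a b) = 1 + rcost a + rcost b"
| "rcost (RSub a b) = 1 + rcost a + rcost b"
| "rcost (RMul a b) = 1 + rcost a + rcost b"
| "rcost (RDiv a b) = 1 + rcost a + rcost b"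
| "rcost (RSqrt a) = 1 + rcost a"
| "rcost (RLn a) = 1 + rcost a"

primrec bcost :: "bexp \<Rightarrow> nat" where
  "bcost (ILess a b) = 1 + icost a + icost b"
| "bcost (RLess a b) = 1 + rcost a + rcost b"
| "bcost (BNot b) = 1 + bcost b"
| "bcost (BAnd a b) = 1 + bcost a + bcost b"

text \<open>\<open>exec c s t s'\<close>: started in \<open>s\<close>, the program \<open>c\<close> halts in \<open>s'\<close> after exactly \<open>t\<close> steps.\<close>

inductive exec :: "com \<Rightarrow> ram \<Rightarrow> nat \<Rightarrow> ram \<Rightarrow> bool" where
  Skip: "exec Skip s 1 s"
| IAssign: "exec (IAssign v a) s (1 + icost a) (s\<lparr>reg := (reg s)(v := ival a s)\<rparr>)"
| RAssign: "exec (RAssign a i e) s (1 + icost i + rcost e)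
     (s\<lparr>cell := (cell s)(a := (cell s a)(ival i s := rval e s))\<rparr>)"
| Seq: "exec c1 s t1 s1 \<Longrightarrow> exec c2 s1 t2 s2 \<Longrightarrow> exec (Seq c1 c2) s (t1 + t2) s2"
| CondTrue: "bval b s \<Longrightarrow> exec c1 s t s' \<Longrightarrow> exec (Cond b c1 c2) s (1 + bcost b + t) s'"
| CondFalse: "\<not> bval b s \<Longrightarrow> exec c2 s t s' \<Longrightarrow> exec (Cond b c1 c2) s (1 + bcost b + t) s'"
| WhileFalse: "\<not> bval b s \<Longrightarrow> exec (While b c) s (1 + bcost b) s"
| WhileTrue: "bval b s \<Longrightarrow> exec c s t1 s1 \<Longrightarrow> exec (While b c) s1 t2 s2 \<Longrightarrow>
     exec (While b c) s (1 + bcost b + t1 + t2) s2"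

inductive_cases exec_elims:
  "exec Skip s t s'" "exec (IAssign v a) s t s'" "exec (RAssign a i e) s t s'"
  "exec (Seq c1 c2) s t s'" "exec (Cond b c1 c2) s t s'" "exec (While b c) s t s'"

lemma exec_deterministic: "exec c s t s' \<Longrightarrow> exec c s t' s'' \<Longrightarrow> t' = t \<and> s'' = s'"
proof (induction arbitrary: t' s'' rule: exec.induct)
  case (Skip s)
  then show ?case by (rule exec_elims(1)) simp
next
  case (IAssign v a s)
  then show ?case by (rule exec_elims(2)) simp
next
  case (RAssign a i e s)
  then show ?case by (rule exec_elims(3)) simp
next
  case (Seq c1 s t1 s1 c2 t2 s2)
  from Seq.prems show ?case
    by (rule exec_elims(4)) (auto dest!: Seq.IH)
next
  case (CondTrue b s c1 t s' c2)
  from CondTrue.prems show ?case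
    by (rule exec_elims(5)) (auto dest!: CondTrue.IH simp: CondTrue.hyps)
next
  case (CondFalse b s c2 t s' c1)
  from CondFalse.prems show ?case
    by (rule exec_elims(5)) (auto dest!: CondFalse.IH simp: CondFalse.hyps)
next
  case (WhileFalse b s c)
  from WhileFalse.prems show ?case
    by (rule exec_elims(6)) (auto simp: WhileFalse.hyps)
next
  case (WhileTrue b s c t1 s1 t2 s2)
  from WhileTrue.prems show ?case
    by (rule exec_elims(6)) (auto dest!: WhileTrue.IH simp: WhileTrue.hyps)
qed

definition ram_input :: "nat \<Rightarrow> (nat \<Rightarrow> real) \<Rightarrow> (nat \<Rightarrow> real) \<Rightarrow> real \<Rightarrow> ram" where
  "ram_input n x Y k =
     \<lparr>reg = (\<lambda>_. 0)(''n'' := n),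
      cell = (\<lambda>_ _. 0)
        (''x'' := (\<lambda>i. if i \<in> {1..n} then ereal (x i) else 0),
         ''Y'' := (\<lambda>i. if i \<in> {1..n} then ereal (Y i) else 0),
         ''kappa'' := (\<lambda>i. if i = 0 then ereal k else 0))\<rparr>"

end

theory Submission
  imports Defs
begin

text \<open>
  The bound at a point is attained by (generalised) lines through data points.  If a convex \<open>g\<close>
  passes the test, replace it by any function \<open>h\<close> that does not exceed the data points which \<open>g\<close> does
  not exceed: the signs do not increase, the statistic is monotone in the signs, so \<open>h\<close> passes as well.
  Among the convex functions not exceeding a given finite set of points, one with the largest value at \<open>t\<close>
  is a line through one of the points, or the constant \<open>\<infinity>\<close> if there are none.  Its slope points towards another one or is infinite, where
  infinite slopes encode the limits of ever steeper lines (\<open>extremal_one_sided\<close>, \<open>extremal_two_sided\<close>).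
  The lines do not depend on the unknown set of points: for the \<open>O(n\<^sup>2)\<close> pairs of a pivot and a
  point defining the slope, it suffices to test the line and to take the maximum over those that pass
  (\<open>U_hat_eq_best\<close>).

  The test of a single line takes \<open>O(n\<^sup>2)\<close> steps, because every local statistic is a second difference of the
  doubly cumulated signs (\<open>T_loc_eq_ramp_sum\<close>) and thus costs \<open>O(1)\<close>, and because the normalising constant has a
  closed form (\<open>beta_scale_eq\<close>).  One line, once tested, serves all \<open>n\<close> points simultaneously.  Altogether
  this yields \<open>O(n\<^sup>4)\<close> steps, which \<open>runs_band_program\<close> establishes for an explicit program.
\<close>


section \<open>Convex functions below finitely many points\<close>

text \<open>
  The slope \<open>s\<close> may be infinite.  As \<open>\<infinity> * 0 = 0\<close> in \<^typ>\<open>ereal\<close>, the line then is the limit of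
  lines turning about the pivot \<open>(a, b)\<close>: it is \<open>b\<close> at \<open>a\<close>, and \<open>\<plusminus>\<infinity>\<close> on the two sides.
  As \<open>\<infinity> + v = \<infinity>\<close>, a line with \<open>b = \<infinity>\<close> is constant, whatever the slope.
\<close>

definition line :: "real \<Rightarrow> ereal \<Rightarrow> ereal \<Rightarrow> real \<Rightarrow> ereal" where
  "line a b s z = b + s * ereal (z - a)"

lemma convex_fun_iff:
  "convex_fun g \<longleftrightarrow> (\<forall>z1 y1 z2 y2 u v. g z1 \<le> ereal y1 \<longrightarrow> g z2 \<le> ereal y2 \<longrightarrow>
     0 < u \<longrightarrow> 0 < v \<longrightarrow> u + v = 1 \<longrightarrow> g (u * z1 + v * z2) \<le> ereal (u * y1 + v * y2))"
  (is "_ \<longleftrightarrow> ?R")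
proof
  assume c: "convex_fun g"
  show ?R
  proof (intro allI impI)
    fix z1 y1 z2 y2 u v :: real
    assume a: "g z1 \<le> ereal y1" "g z2 \<le> ereal y2" "0 < u" "0 < v" "u + v = 1"
    have "u *\<^sub>R (z1, y1) + v *\<^sub>R (z2, y2) \<in> {(x, y). g x \<le> ereal y}"
      using c a unfolding convex_fun_def by (intro convexD) auto
    then show "g (u * z1 + v * z2) \<le> ereal (u * y1 + v * y2)" by simp
  qed
next
  assume r: ?R
  show "convex_fun g"
    unfolding convex_fun_def
  proof (rule convexI)
    fix p q :: "real \<times> real" and u v :: real
    assume a: "p \<in> {(x, y). g x \<le> ereal y}" "q \<in> {(x, y). g x \<le> ereal y}"
      "0 \<le> u" "0 \<le> v" "u + v = 1"
    show "u *\<^sub>R p + v *\<^sub>R q \<in> {(x, y). g x \<le> ereal y}"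
    proof (cases "u = 0 \<or> v = 0")
      case True
      then show ?thesis using a by (auto simp: scaleR_prod_def split: prod.splits)
    next
      case False
      then show ?thesis using a r by (cases p; cases q) auto
    qed
  qed
qed

text \<open>
  The sign \<open>c\<close> selects the slope \<open>\<infinity>\<close> or \<open>- \<infinity>\<close>, so that the two mirror images are treated by one argument.
\<close>

lemma line_vertical_le_iff:
  assumes "c = 1 \<or> c = - 1"
  shows "line a (ereal b) (ereal c * \<infinity>) z \<le> ereal y \<longleftrightarrow> c * z < c * a \<or> z = a \<and> b \<le> y"
proof -
  have "z < a \<or> z = a \<or> a < z" by linarith
  then show ?thesis using assms by (auto simp: line_def)
qed

lemma convex_line:
  assumes "b \<noteq> - \<infinity>"
  shows "convex_fun (line a b s)"
proof (cases b)
  case PInf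
  then show ?thesis by (simp add: convex_fun_iff line_def)
next
  case MInf
  then show ?thesis using assms by simp
next
  case b: (real r)
  have vert: "convex_fun (line a b (ereal c * \<infinity>))" if c: "c = 1 \<or> c = - 1" for c
    unfolding convex_fun_iff b line_vertical_le_iff[OF c]
  proof (intro allI impI)
    fix z1 y1 z2 y2 u v :: real
    assume h: "c * z1 < c * a \<or> z1 = a \<and> r \<le> y1" "c * z2 < c * a \<or> z2 = a \<and> r \<le> y2"
      "0 < u" "0 < v" "u + v = 1"
    have u: "u = 1 - v" using h by simp
    have e: "c * (u * z1 + v * z2) = u * (c * z1) + v * (c * z2)"
      "c * a = u * (c * a) + v * (c * a)"
      using h(5) by (simp_all add: algebra_simps flip: distrib_right) (simp add: u algebra_simps)
    show "c * (u * z1 + v * z2) < c * a \<or> u * z1 + v * z2 = a \<and> r \<le> u * y1 + v * y2"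
    proof (cases "c * z1 < c * a \<or> c * z2 < c * a")
      case True
      have "c * z1 \<le> c * a" "c * z2 \<le> c * a" using h by auto
      then have "u * (c * z1) + v * (c * z2) < u * (c * a) + v * (c * a)"
        using True h(3,4) by (auto intro: add_less_le_mono add_le_less_mono)
      then show ?thesis using e by simp
    next
      case False
      then have z: "z1 = a" "z2 = a" "r \<le> y1" "r \<le> y2" using h by auto
      have "u * r + v * r \<le> u * y1 + v * y2" using z h by (intro add_mono) auto
      moreover have "u * r + v * r = r" "u * a + v * a = a"
        using h(5) by (simp_all flip: distrib_right)
      ultimately show ?thesis using z by simp
    qed
  qed
  show ?thesis
  proof (cases s)
    case PInf
    then show ?thesis using vert[of 1] by simp
  next
    case MInf
    then show ?thesis using vert[of "-1"] by simp
  next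
    case (real c)
    show ?thesis
      unfolding convex_fun_iff
    proof (intro allI impI)
      fix z1 y1 z2 y2 u v :: real
      assume h: "line a b s z1 \<le> ereal y1" "line a b s z2 \<le> ereal y2" "0 < u" "0 < v" "u + v = 1"
      have l: "r + c * (z1 - a) \<le> y1" "r + c * (z2 - a) \<le> y2"
        using h by (simp_all add: line_def b real)
      have "u * (r + c * (z1 - a)) + v * (r + c * (z2 - a)) \<le> u * y1 + v * y2"
        using l h by (intro add_mono mult_left_mono) auto
      moreover have "u * (r + c * (z1 - a)) + v * (r + c * (z2 - a)) =
          r + c * (u * z1 + v * z2 - a)"
      proof -
        have u: "u = 1 - v" using h by simp
        show ?thesis unfolding u by (simp add: algebra_simps)
      qed
      ultimately show "line a b s (u * z1 + v * z2) \<le> ereal (u * y1 + v * y2)"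
        by (simp add: line_def b real)
    qed
  qed
qed

lemma convex_fun_le_chord:
  assumes "convex_fun g" "g z1 \<le> ereal y1" "g z2 \<le> ereal y2" "z1 < t" "t < z2"
  shows "g t \<le> ereal (y1 + (y2 - y1) / (z2 - z1) * (t - z1))"
proof -
  let ?v = "(t - z1) / (z2 - z1)"
  have v: "0 < ?v" "?v < 1" using assms by auto
  have "g ((1 - ?v) * z1 + ?v * z2) \<le> ereal ((1 - ?v) * y1 + ?v * y2)"
    using assms(1)[unfolded convex_fun_iff, rule_format, of z1 y1 z2 y2 "1 - ?v" ?v] assms(2-3) v by simp
  moreover have affine: "(1 - v) * a + v * b = a + v * (b - a)" for v a b :: real
    by (simp add: algebra_simps)
  moreover have "?v * (z2 - z1) = t - z1" "?v * (y2 - y1) = (y2 - y1) / (z2 - z1) * (t - z1)"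
    using assms by simp_all
  ultimately show ?thesis unfolding affine by (simp add: mult.commute)
qed

lemma finite_ex_min:
  fixes f :: "'a \<Rightarrow> real"
  assumes "finite A" "A \<noteq> {}"
  obtains a where "a \<in> A" "\<And>b. b \<in> A \<Longrightarrow> f a \<le> f b"
  using assms by (metis arg_min_if_finite(1) arg_min_least)

definition is_extremal ::
    "'i set \<Rightarrow> ('i \<Rightarrow> real) \<Rightarrow> ('i \<Rightarrow> real) \<Rightarrow> real \<Rightarrow> (real \<Rightarrow> ereal) \<Rightarrow> bool" where
  "is_extremal I x y t h \<longleftrightarrow> (\<forall>l\<in>I. h (x l) \<le> ereal (y l)) \<and>
     (\<forall>g. convex_fun g \<longrightarrow> (\<forall>l\<in>I. g (x l) \<le> ereal (y l)) \<longrightarrow> g t \<le> h t)"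

text \<open>
  If no data point lies beyond \<open>t\<close>, then the pivot is the lowest one among those closest to \<open>t\<close>, and the
  line is vertical, falling to \<open>- \<infinity>\<close> over the points further away.  Its value at \<open>t\<close> is \<open>\<infinity>\<close>,
  or it is the ordinate of a data point at \<open>t\<close>, which bounds every competitor.
\<close>

lemma extremal_one_sided:
  assumes "finite I" "I \<noteq> {}" and c: "c = 1 \<or> c = - 1"
    and side: "\<And>i. i \<in> I \<Longrightarrow> c * x i \<le> c * t"
  shows "\<exists>i\<in>I. is_extremal I x y t (line (x i) (ereal (y i)) (ereal c * \<infinity>))"
proof -
  obtain i0 where i0: "i0 \<in> I" "\<And>j. j \<in> I \<Longrightarrow> - (c * x i0) \<le> - (c * x j)"
    using finite_ex_min[OF assms(1,2), of "\<lambda>i. - (c * x i)"] by blast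
  have "finite {i\<in>I. x i = x i0}" "{i\<in>I. x i = x i0} \<noteq> {}" using i0 assms by auto
  then obtain i where i: "i \<in> {i\<in>I. x i = x i0}" "\<And>j. j \<in> {i\<in>I. x i = x i0} \<Longrightarrow> y i \<le> y j"
    using finite_ex_min[of "{i\<in>I. x i = x i0}" y] by blast
  have below: "c * x l < c * x i \<or> x l = x i \<and> y i \<le> y l" if "l \<in> I" for l
  proof (cases "x l = x i0")
    case True
    then show ?thesis using i that by auto
  next
    case False
    then have "c * x l \<noteq> c * x i0" using c by auto
    then have "c * x l < c * x i0" using i0(2)[OF that] by linarith
    then show ?thesis using i by simp
  qed
  moreover have "g t \<le> line (x i) (ereal (y i)) (ereal c * \<infinity>) t"
    if "\<forall>l\<in>I. g (x l) \<le> ereal (y l)" for g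
  proof (cases "x i = t")
    case True
    then show ?thesis using that i by (auto simp: line_def)
  next
    case False
    then have "c * x i < c * t" using side[of i] i c by auto
    then have "line (x i) (ereal (y i)) (ereal c * \<infinity>) t = \<infinity>"
      using c by (auto simp: line_def)
    then show ?thesis by simp
  qed
  ultimately show ?thesis
    using i unfolding is_extremal_def line_vertical_le_iff[OF c] by blast
qed

text \<open>
  With data points on both sides of \<open>t\<close>, convexity bounds \<open>g t\<close> by every chord across \<open>t\<close> and by every
  data point at \<open>t\<close>.  If the lowest of these bounds is a chord, then the line through its endpoints
  passes below all points, because a point below it would yield a lower chord.  If it is a data point at
  \<open>t\<close>, then the line through that point with the least slope towards a point on the right
  passes below the points on the right by choice, and below those on the left because no chord passes
  below the pivot.
\<close>

lemma extremal_two_sided: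
  assumes fin: "finite I" and l0: "l0 \<in> I" "x l0 < t" and r0: "r0 \<in> I" "t < x r0"
  shows "\<exists>i\<in>I. \<exists>j\<in>I. x i \<noteq> x j \<and>
    is_extremal I x y t (line (x i) (ereal (y i)) (ereal ((y j - y i) / (x j - x i))))"
proof -
  define L where "L = {i\<in>I. x i < t}"
  define R where "R = {i\<in>I. t < x i}"
  define ch where "ch = (\<lambda>(l, r). y l + (y r - y l) / (x r - x l) * (t - x l))"
  have "finite (L \<times> R)" "L \<times> R \<noteq> {}" using assms by (auto simp: L_def R_def)
  then obtain p where p: "p \<in> L \<times> R" "\<And>q. q \<in> L \<times> R \<Longrightarrow> ch p \<le> ch q"
    using finite_ex_min[of "L \<times> R" ch] by blast
  obtain l r where lr: "p = (l, r)" by (cases p)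
  have l: "l \<in> I" "x l < t" and r: "r \<in> I" "t < x r" using p lr by (auto simp: L_def R_def)
  have ch_min: "ch (l, r) \<le> ch (l', r')" if "l' \<in> L" "r' \<in> R" for l' r'
    using p(2)[of "(l', r')"] that lr by simp
  \<comment> \<open>This form is symmetric under exchanging the two endpoints, so it serves for both sides.\<close>
  have ch_le: "ch (l', r') \<ge> v \<longleftrightarrow> (v - y l') * (x r' - t) \<le> (y r' - v) * (t - x l')"
    if "x l' < t" "t < x r'" for l' r' v
  proof -
    have "ch (l', r') \<ge> v \<longleftrightarrow> (v - y l') * (x r' - x l') \<le> (y r' - y l') * (t - x l')"
      using that by (simp add: ch_def pos_le_divide_eq pos_divide_le_eq field_simps)
    then show ?thesis by (simp add: algebra_simps)
  qed
  show ?thesis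
  proof (cases "\<exists>i\<in>I. x i = t \<and> y i < ch (l, r)")
    case True
    have "finite {i\<in>I. x i = t}" "{i\<in>I. x i = t} \<noteq> {}" using fin True by auto
    then obtain i where i0: "i \<in> {i\<in>I. x i = t}" "\<And>j. j \<in> {i\<in>I. x i = t} \<Longrightarrow> y i \<le> y j"
      using finite_ex_min[of "{i\<in>I. x i = t}" y] by blast
    have i: "i \<in> I" "x i = t" "y i < ch (l, r)" using i0 True by force+
    have "finite R" "R \<noteq> {}" using fin r0 by (auto simp: R_def)
    then obtain j where j: "j \<in> R" "\<And>r. r \<in> R \<Longrightarrow> (y j - y i) / (x j - t) \<le> (y r - y i) / (x r - t)"
      using finite_ex_min[of R "\<lambda>r. (y r - y i) / (x r - t)"] by blast
    have xj: "t < x j" "j \<in> I" using j by (auto simp: R_def)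
    have "is_extremal I x y t (line (x i) (ereal (y i)) (ereal ((y j - y i) / (x j - x i))))"
      unfolding is_extremal_def
    proof (intro conjI ballI allI impI)
      fix m assume m: "m \<in> I"
      have "y i + (y j - y i) / (x j - t) * (x m - t) \<le> y m"
      proof -
        consider "x m < t" | "x m = t" | "t < x m" by linarith
        then show ?thesis
        proof cases
          case 1
          then have "ch (m, j) \<ge> y i" using ch_min[of m j] m j i by (simp add: L_def)
          then have "(y i - y m) * (x j - t) \<le> (y j - y i) * (t - x m)"
            using ch_le[OF 1 xj(1)] by simp
          then have "y i - y m \<le> (y j - y i) / (x j - t) * (t - x m)"
            using xj by (simp add: pos_le_divide_eq)
          moreover have "s * (x m - t) = - (s * (t - x m))" for s :: real by (simp add: algebra_simps)
          ultimately show ?thesis by (simp del: times_divide_eq_left)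
        next
          case 2
          then show ?thesis using i0 m by simp
        next
          case 3
          then have "(y j - y i) / (x j - t) \<le> (y m - y i) / (x m - t)" using j m by (simp add: R_def)
          then show ?thesis using 3 by (simp add: pos_le_divide_eq)
        qed
      qed
      then show "line (x i) (ereal (y i)) (ereal ((y j - y i) / (x j - x i))) (x m) \<le> ereal (y m)"
        by (simp add: line_def i)
    next
      fix g assume "convex_fun g" "\<forall>l\<in>I. g (x l) \<le> ereal (y l)"
      then show "g t \<le> line (x i) (ereal (y i)) (ereal ((y j - y i) / (x j - x i))) t"
        using i by (auto simp: line_def)
    qed
    then show ?thesis using i xj by (metis less_irrefl)
  next
    case False
    have "is_extremal I x y t (line (x l) (ereal (y l)) (ereal ((y r - y l) / (x r - x l))))"
      unfolding is_extremal_def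
    proof (intro conjI ballI allI impI)
      fix m assume m: "m \<in> I"
      let ?v = "ch (l, r)"
      define s where "s = (y r - y l) / (x r - x l)"
      have sv: "?v = y l + s * (t - x l)" by (simp add: ch_def s_def)
      have sr: "y r - ?v = s * (x r - t)"
        using l r unfolding sv s_def by (simp add: field_simps)
      have "y l + s * (x m - x l) = ?v + s * (x m - t)" by (simp add: sv algebra_simps)
      also have "\<dots> \<le> y m"
      proof -
        consider "x m < t" | "x m = t" | "t < x m" by linarith
        then show ?thesis
        proof cases
          case 1
          then have "(?v - y m) * (x r - t) \<le> s * (x r - t) * (t - x m)"
            using ch_min[of m r] m r ch_le[OF 1 r(2), of ?v] sr by (simp add: L_def R_def)
          then have "(?v - y m) * (x r - t) \<le> (s * (t - x m)) * (x r - t)"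
            by (simp add: mult.commute mult.left_commute)
          then have "?v - y m \<le> s * (t - x m)" using r by simp
          then show ?thesis by (simp add: algebra_simps)
        next
          case 2
          then show ?thesis using False m by auto
        next
          case 3
          then have "(?v - y l) * (x m - t) \<le> (y m - ?v) * (t - x l)"
            using ch_min[of l m] m l ch_le[OF l(2) 3, of ?v] by (simp add: L_def R_def)
          then have "(s * (x m - t)) * (t - x l) \<le> (y m - ?v) * (t - x l)"
            by (simp add: sv mult.commute mult.left_commute)
          then have "s * (x m - t) \<le> y m - ?v" using l by simp
          then show ?thesis by simp
        qed
      qed
      finally show "line (x l) (ereal (y l)) (ereal ((y r - y l) / (x r - x l))) (x m) \<le> ereal (y m)"
        by (simp add: line_def s_def)
    next
      fix g assume "convex_fun g" "\<forall>l\<in>I. g (x l) \<le> ereal (y l)"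
      then show "g t \<le> line (x l) (ereal (y l)) (ereal ((y r - y l) / (x r - x l))) t"
        using convex_fun_le_chord[of g "x l" "y l" "x r" "y r" t] l r by (auto simp: line_def)
    qed
    then show ?thesis using l r by (metis less_irrefl less_trans)
  qed
qed


section \<open>Evaluating the test statistic\<close>

lemma sgn_low_minus_ereal: "sgn_low (v - ereal r) = (if v \<le> ereal r then - 1 else 1)"
  by (cases v) (auto simp: sgn_low_def)

text \<open>
  The program only has to compare the statistic with \<open>k\<close>, so it needs no maximum but a conjunction.
\<close>

lemma T_o_le_iff:
  assumes "n \<ge> 1"
  shows "T_o n \<sigma> \<le> k \<longleftrightarrow>
    (\<forall>d\<in>{1..(n + 1) div 2}. \<forall>j\<in>{1..n}. T_loc n d j \<sigma> - Gam ((2 * real d - 1) / real n) \<le> k)"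
proof -
  have "T_o n \<sigma> \<le> k \<longleftrightarrow>
    (\<forall>d\<in>{1..(n + 1) div 2}. (MAX j\<in>{1..n}. T_loc n d j \<sigma>) - Gam ((2 * real d - 1) / real n) \<le> k)"
    using assms unfolding T_o_def by (subst Max_le_iff) auto
  also have "\<dots> \<longleftrightarrow> (\<forall>d\<in>{1..(n + 1) div 2}.
      (MAX j\<in>{1..n}. T_loc n d j \<sigma>) \<le> k + Gam ((2 * real d - 1) / real n))"
    by (simp add: algebra_simps)
  also have "\<dots> \<longleftrightarrow> (\<forall>d\<in>{1..(n + 1) div 2}. \<forall>j\<in>{1..n}.
      T_loc n d j \<sigma> \<le> k + Gam ((2 * real d - 1) / real n))"
    using assms by (subst Max_le_iff) auto
  finally show ?thesis by (simp add: algebra_simps)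
qed

lemma T_loc_mono:
  assumes "\<And>i. i \<in> {1..n} \<Longrightarrow> \<sigma> i \<le> \<tau> i"
  shows "T_loc n d j \<sigma> \<le> T_loc n d j \<tau>"
  unfolding T_loc_def beta_scale_def
  using assms by (intro mult_left_mono sum_mono) (auto simp: psi_def)

lemma T_o_mono:
  assumes "n \<ge> 1" "\<And>i. i \<in> {1..n} \<Longrightarrow> \<sigma> i \<le> \<tau> i" "T_o n \<tau> \<le> k"
  shows "T_o n \<sigma> \<le> k"
  using assms(3) T_loc_mono[of n \<sigma> \<tau>, OF assms(2)] unfolding T_o_le_iff[OF assms(1)]
  by (smt (verit))

text \<open>
  The tent \<open>psi\<close> is a second difference of the ramp \<open>max (m - i) 0\<close>.  Hence all local statistics are second
  differences, with step \<open>d\<close>, of one sequence, and this sequence satisfies a two-term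
  recurrence: after \<open>O(n)\<close> steps of preparation, each local statistic costs \<open>O(1)\<close> steps.
\<close>

definition ramp_sum :: "nat \<Rightarrow> (nat \<Rightarrow> real) \<Rightarrow> nat \<Rightarrow> real" where
  "ramp_sum n \<sigma> m = (\<Sum>i = 1..n. max (real m - real i) 0 * \<sigma> i)"

lemma ramp_sum_0: "ramp_sum n \<sigma> 0 = 0"
  by (simp add: ramp_sum_def)

text \<open>
  For \<open>m = 0\<close> the truncated \<open>m - 1\<close> is \<open>0\<close>, which is harmless because the sequence vanishes at \<open>0\<close> and \<open>1\<close>.
\<close>

lemma ramp_sum_Suc:
  "ramp_sum n \<sigma> (Suc m) =
     2 * ramp_sum n \<sigma> m - ramp_sum n \<sigma> (m - 1) + (if m \<in> {1..n} then \<sigma> m else 0)"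
proof -
  have "max (real (Suc m) - real i) 0 * \<sigma> i = 2 * (max (real m - real i) 0 * \<sigma> i)
      - max (real (m - 1) - real i) 0 * \<sigma> i + (if m = i then \<sigma> i else 0)" if "i \<in> {1..n}" for i
  proof -
    have "max (real (Suc m) - real i) 0 = 2 * max (real m - real i) 0 - max (real (m - 1) - real i) 0
        + (if m = i then 1 else 0)"
      using that by (auto simp: max_def)
    then have "max (real (Suc m) - real i) 0 * \<sigma> i = (2 * max (real m - real i) 0
        - max (real (m - 1) - real i) 0 + (if m = i then 1 else 0)) * \<sigma> i" by (rule arg_cong)
    then show ?thesis by (simp only: distrib_right left_diff_distrib mult.assoc) simp
  qed
  then have "ramp_sum n \<sigma> (Suc m) = (\<Sum>i = 1..n. 2 * (max (real m - real i) 0 * \<sigma> i)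
      - max (real (m - 1) - real i) 0 * \<sigma> i + (if m = i then \<sigma> i else 0))"
    unfolding ramp_sum_def by (intro sum.cong) auto
  then show ?thesis
    by (simp add: ramp_sum_def sum.distrib sum_subtractf sum_distrib_left)
qed

text \<open>
  Truncation of \<open>j - d\<close> at \<open>0\<close> does no harm either: the ramps vanish at all arguments up to \<open>1\<close>.
\<close>

lemma T_loc_eq_ramp_sum:
  assumes "d \<ge> 1"
  shows "T_loc n d j \<sigma> = beta_scale d / real d *
     (ramp_sum n \<sigma> (j + d) + ramp_sum n \<sigma> (j - d) - 2 * ramp_sum n \<sigma> j)"
proof -
  have "real d * (psi ((real i - real j) / real d) * \<sigma> i) = max (real (j + d) - real i) 0 * \<sigma> i
      + max (real (j - d) - real i) 0 * \<sigma> i - 2 * (max (real j - real i) 0 * \<sigma> i)"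
    if "i \<in> {1..n}" for i
  proof -
    have "real d * psi ((real i - real j) / real d) = max (real d - \<bar>real i - real j\<bar>) 0"
      using assms by (simp add: psi_def max_mult_distrib_left algebra_simps)
    also have "\<dots> = max (real (j + d) - real i) 0 + max (real (j - d) - real i) 0
        - 2 * max (real j - real i) 0"
      using that by (auto simp: max_def abs_if of_nat_diff_if)
    finally have "(real d * psi ((real i - real j) / real d)) * \<sigma> i = (max (real (j + d) - real i) 0
        + max (real (j - d) - real i) 0 - 2 * max (real j - real i) 0) * \<sigma> i" by (rule arg_cong)
    then show ?thesis by (simp add: algebra_simps)
  qed
  then have "real d * (\<Sum>i = 1..n. psi ((real i - real j) / real d) * \<sigma> i) =
      ramp_sum n \<sigma> (j + d) + ramp_sum n \<sigma> (j - d) - 2 * ramp_sum n \<sigma> j"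
    unfolding ramp_sum_def sum_distrib_left sum.distrib[symmetric] sum_subtractf[symmetric]
    by (intro sum.cong) auto
  from this[symmetric] show ?thesis using assms by (simp add: T_loc_def)
qed

text \<open>
  The parameter \<open>D\<close> is decoupled from the summation bound \<open>m\<close> to make induction on \<open>m\<close> possible.
\<close>

lemma sum_tent_squares:
  assumes "m \<ge> 1"
  shows "(\<Sum>i = 1 - int m..int m - 1. (D - \<bar>real_of_int i\<bar>)\<^sup>2) =
    D\<^sup>2 + 2 * ((real m - 1) * D\<^sup>2 - D * real m * (real m - 1) + (real m - 1) * real m * (2 * real m - 1) / 6)"
  using assms
proof (induction m rule: dec_induct)
  case base
  then show ?case by simp
next
  case (step m)
  have "{1 - int (Suc m)..int (Suc m) - 1} = insert (- int m) (insert (int m) {1 - int m..int m - 1})"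
    using step by auto
  then show ?case
    using step by (simp add: power2_eq_square field_simps)
qed

lemma beta_scale_eq:
  assumes "d \<ge> 1"
  shows "beta_scale d = 1 / sqrt ((2 * real d * real d + 1) / (3 * real d))"
proof -
  have "(psi (real_of_int i / real d))\<^sup>2 = (real d - \<bar>real_of_int i\<bar>)\<^sup>2 / (real d)\<^sup>2"
    if "i \<in> {1 - int d..int d - 1}" for i
  proof -
    have "\<bar>real_of_int i\<bar> \<le> real d" using that by auto
    then have "psi (real_of_int i / real d) = (real d - \<bar>real_of_int i\<bar>) / real d"
      using assms by (simp add: psi_def diff_divide_distrib)
    then show ?thesis by (simp add: power_divide)
  qed
  then have "(\<Sum>i = 1 - int d..int d - 1. (psi (real_of_int i / real d))\<^sup>2) =
      (\<Sum>i = 1 - int d..int d - 1. (real d - \<bar>real_of_int i\<bar>)\<^sup>2) / (real d)\<^sup>2"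
    unfolding sum_divide_distrib by (intro sum.cong) auto
  also have "\<dots> = (2 * real d * real d + 1) / (3 * real d)"
    unfolding sum_tent_squares[OF assms] using assms by (simp add: power2_eq_square field_simps)
  finally show ?thesis
    using assms by (simp add: beta_scale_def powr_minus_divide powr_half_sqrt)
qed

lemma Gam_eq:
  assumes "d \<ge> 1" "2 * d \<le> n + 1"
  shows "Gam ((2 * real d - 1) / real n) = sqrt (2 * (1 + ln (real n / (2 * real d - 1))))"
proof -
  have "real n > 0" "2 * real d - 1 \<ge> 1" "2 * real d - 1 \<le> real n" using assms by auto
  then have "1 \<le> real n / (2 * real d - 1)" by simp
  then have ln: "0 \<le> ln (real n / (2 * real d - 1))" by simp
  have "ln (exp 1 / ((2 * real d - 1) / real n)) = 1 + ln (real n / (2 * real d - 1))"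
  proof -
    have "ln (exp 1 * (real n / (2 * real d - 1))) = ln (exp 1) + ln (real n / (2 * real d - 1))"
      using \<open>1 \<le> real n / (2 * real d - 1)\<close> by (intro ln_mult_pos) auto
    then show ?thesis by simp
  qed
  then show ?thesis using ln by (simp add: Gam_def powr_half_sqrt)
qed

section \<open>The bound as a maximum over candidate lines\<close>

text \<open>
  The data are augmented by the points \<open>(x 1 - 1, \<infinity>)\<close> and \<open>(x n + 1, \<infinity>)\<close>, with indices \<open>0\<close> and \<open>n + 1\<close>.
  The quotient of differences from a data point towards these is \<open>- \<infinity>\<close> and \<open>\<infinity>\<close>, respectively, and
  the line with pivot \<open>0\<close> is the constant \<open>\<infinity>\<close>.  So the vertical lines and the constant \<open>\<infinity>\<close> need no
  separate treatment.
\<close>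

definition node_x :: "nat \<Rightarrow> (nat \<Rightarrow> real) \<Rightarrow> nat \<Rightarrow> real" where
  "node_x n x p = (if p = 0 then x 1 - 1 else if p = n + 1 then x n + 1 else x p)"

definition node_y :: "nat \<Rightarrow> (nat \<Rightarrow> real) \<Rightarrow> nat \<Rightarrow> ereal" where
  "node_y n Y p = (if p = 0 \<or> p = n + 1 then \<infinity> else ereal (Y p))"

definition cand :: "nat \<Rightarrow> (nat \<Rightarrow> real) \<Rightarrow> (nat \<Rightarrow> real) \<Rightarrow> nat \<times> nat \<Rightarrow> real \<Rightarrow> ereal" where
  "cand n x Y = (\<lambda>(p, q). line (node_x n x p) (node_y n Y p)
     ((node_y n Y q - node_y n Y p) / ereal (node_x n x q - node_x n x p)))"

definition feasible :: "nat \<Rightarrow> (nat \<Rightarrow> real) \<Rightarrow> (nat \<Rightarrow> real) \<Rightarrow> real \<Rightarrow> (real \<Rightarrow> ereal) \<Rightarrow> bool" where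
  "feasible n x Y k g \<longleftrightarrow> T_o n (\<lambda>i. sgn_low (g (x i) - ereal (Y i))) \<le> k"

definition best ::
    "nat \<Rightarrow> (nat \<Rightarrow> real) \<Rightarrow> (nat \<Rightarrow> real) \<Rightarrow> real \<Rightarrow> (nat \<times> nat) set \<Rightarrow> real \<Rightarrow> ereal" where
  "best n x Y k A t = (SUP pq\<in>{pq\<in>A. feasible n x Y k (cand n x Y pq)}. cand n x Y pq t)"

text \<open>
  Only the data points on or above the graph of \<open>g\<close> matter, since they carry the sign \<open>- 1\<close>.
\<close>

lemma feasible_mono:
  assumes "n \<ge> 1" "feasible n x Y k g"
    and "\<And>i. i \<in> {1..n} \<Longrightarrow> g (x i) \<le> ereal (Y i) \<Longrightarrow> h (x i) \<le> ereal (Y i)"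
  shows "feasible n x Y k h"
  using assms unfolding feasible_def by (auto simp: sgn_low_minus_ereal elim!: T_o_mono[rotated 2])

text \<open>
  Every candidate is convex, hence a feasible one is admitted in the supremum.  Conversely, for an admitted
  \<open>g\<close> let \<open>I\<close> be the set of data points not below it.  An extremal line for \<open>I\<close> is a candidate, has no sign
  \<open>1\<close> where \<open>g\<close> has sign \<open>- 1\<close>, hence is feasible, and it dominates \<open>g\<close> at the point in question.
\<close>

lemma U_hat_eq_best:
  assumes n: "n \<ge> 1" and mono: "mono_on {1..n} x" and m: "m \<in> {1..n}"
  shows "U_hat n x Y k (x m) = best n x Y k ({..n} \<times> {..n + 1}) (x m)"
proof (rule antisym)
  have "node_y n Y p \<noteq> - \<infinity>" for p by (simp add: node_y_def)
  then have "convex_fun (cand n x Y pq)" for pq by (auto simp: cand_def split: prod.splits intro: convex_line)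
  then show "best n x Y k ({..n} \<times> {..n + 1}) (x m) \<le> U_hat n x Y k (x m)"
    unfolding best_def U_hat_def
    by (intro SUP_least SUP_upper2[where i = "cand n x Y _"]) (auto simp: feasible_def)
next
  have attained: "h (x m) \<le> best n x Y k ({..n} \<times> {..n + 1}) (x m)"
    if "feasible n x Y k h" "h = cand n x Y (p, q)" "p \<le> n" "q \<le> n + 1" for h p q
    unfolding best_def by (rule SUP_upper2[where i = "(p, q)"]) (use that in auto)
  show "U_hat n x Y k (x m) \<le> best n x Y k ({..n} \<times> {..n + 1}) (x m)"
    unfolding U_hat_def
  proof (rule SUP_least)
    fix g assume "g \<in> {g. convex_fun g \<and> T_o n (\<lambda>i. sgn_low (g (x i) - ereal (Y i))) \<le> k}"
    then have g: "convex_fun g" "feasible n x Y k g" by (auto simp: feasible_def)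
    define I where "I = {i\<in>{1..n}. g (x i) \<le> ereal (Y i)}"
    have I: "finite I" "I \<subseteq> {1..n}" by (auto simp: I_def)
    have nodes: "node_x n x i = x i" "node_y n Y i = ereal (Y i)" if "i \<in> I" for i
      using that I by (auto simp: node_x_def node_y_def)
    have bounds: "node_x n x 0 < x i" "x i < node_x n x (n + 1)" if "i \<in> {1..n}" for i
      using monotone_onD[OF mono, of 1 i] monotone_onD[OF mono, of i n] that by (auto simp: node_x_def)
    have reduce: "g (x m) \<le> best n x Y k ({..n} \<times> {..n + 1}) (x m)"
      if "is_extremal I x Y (x m) h" "h = cand n x Y (p, q)" "p \<le> n" "q \<le> n + 1" for h p q
    proof -
      have "feasible n x Y k h"
        using that(1) by (intro feasible_mono[OF n g(2)]) (auto simp: is_extremal_def I_def)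
      moreover have "g (x m) \<le> h (x m)" using that(1) g by (auto simp: is_extremal_def I_def)
      ultimately show ?thesis using attained[of h p q] that by auto
    qed
    have vertical: "line (x i) (ereal (Y i)) (ereal c * \<infinity>) = cand n x Y (i, if c = 1 then n + 1 else 0)"
      if "i \<in> I" "c = 1 \<or> c = - 1" for i c
    proof -
      have "node_x n x 0 < x i" "x i < node_x n x (n + 1)" using bounds that I by auto
      then show ?thesis using that by (auto simp: cand_def nodes node_y_def divide_ereal_def)
    qed
    consider "I = {}" | "I \<noteq> {}" "\<forall>i\<in>I. x i \<le> x m" | "I \<noteq> {}" "\<forall>i\<in>I. x m \<le> x i"
      | l r where "l \<in> I" "x l < x m" "r \<in> I" "x m < x r"
      by (meson not_le)
    then show "g (x m) \<le> best n x Y k ({..n} \<times> {..n + 1}) (x m)"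
    proof cases
      case 1
      have top: "cand n x Y (0, 0) = (\<lambda>_. \<infinity>)" by (auto simp: cand_def line_def node_y_def)
      have "is_extremal I x Y (x m) (\<lambda>_. \<infinity>)" using 1 by (simp add: is_extremal_def)
      from reduce[OF this top[symmetric]] show ?thesis by simp
    next
      case 2
      then obtain i where "i \<in> I" "is_extremal I x Y (x m) (line (x i) (ereal (Y i)) (ereal 1 * \<infinity>))"
        using extremal_one_sided[OF I(1), of 1 x "x m" Y] by auto
      then show ?thesis using reduce[of _ i "n + 1"] vertical[of i 1] I by auto
    next
      case 3
      then obtain i where "i \<in> I" "is_extremal I x Y (x m) (line (x i) (ereal (Y i)) (ereal (- 1) * \<infinity>))"
        using extremal_one_sided[OF I(1), of "-1" x "x m" Y] by auto
      then show ?thesis using reduce[of _ i 0] vertical[of i "-1"] I by auto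
    next
      case 4
      then obtain i j where ij: "i \<in> I" "j \<in> I" "x i \<noteq> x j"
          "is_extremal I x Y (x m) (line (x i) (ereal (Y i)) (ereal ((Y j - Y i) / (x j - x i))))"
        using extremal_two_sided[OF I(1)] by blast
      then have "line (x i) (ereal (Y i)) (ereal ((Y j - Y i) / (x j - x i))) = cand n x Y (i, j)"
        by (simp add: cand_def nodes)
      moreover have "i \<le> n" "j \<le> n + 1" using ij I by auto
      ultimately show ?thesis using reduce ij by blast
    qed
  qed
qed


section \<open>Total correctness with step counts\<close>

text \<open>
  The postcondition is a parameter, so that sequential composition nests judgements and no intermediate
  assertion has to be guessed.  The step count is only bounded, so that branches of different cost merge.
\<close>

definition runs :: "com \<Rightarrow> ram \<Rightarrow> nat \<Rightarrow> (ram \<Rightarrow> bool) \<Rightarrow> bool" where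
  "runs c s T Q \<longleftrightarrow> (\<exists>t s'. exec c s t s' \<and> t \<le> T \<and> Q s')"

lemma runs_conseq: "runs c s T Q \<Longrightarrow> T \<le> T' \<Longrightarrow> (\<And>s'. Q s' \<Longrightarrow> Q' s') \<Longrightarrow> runs c s T' Q'"
  unfolding runs_def using le_trans by blast

lemma runs_Skip: "1 \<le> T \<Longrightarrow> Q s \<Longrightarrow> runs Skip s T Q"
  unfolding runs_def using exec.Skip by blast

lemma runs_IAssign:
  "1 + icost a \<le> T \<Longrightarrow> Q (s\<lparr>reg := (reg s)(v := ival a s)\<rparr>) \<Longrightarrow> runs (IAssign v a) s T Q"
  unfolding runs_def using exec.IAssign by blast

lemma runs_RAssign:
  "1 + icost i + rcost e \<le> T \<Longrightarrow>
   Q (s\<lparr>cell := (cell s)(a := (cell s a)(ival i s := rval e s))\<rparr>) \<Longrightarrow> runs (RAssign a i e) s T Q"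
  unfolding runs_def using exec.RAssign by blast

lemma runs_Seq:
  assumes "runs c1 s T1 (\<lambda>s1. runs c2 s1 T2 Q)" "T1 + T2 \<le> T"
  shows "runs (Seq c1 c2) s T Q"
proof -
  obtain t1 s1 t2 s2 where "exec c1 s t1 s1" "t1 \<le> T1" "exec c2 s1 t2 s2" "t2 \<le> T2" "Q s2"
    using assms(1) unfolding runs_def by blast
  then show ?thesis
    using assms(2) unfolding runs_def by (meson exec.Seq add_mono le_trans)
qed

lemma runs_Cond:
  assumes "bval b s \<Longrightarrow> runs c1 s T' Q" "\<not> bval b s \<Longrightarrow> runs c2 s T' Q" "1 + bcost b + T' \<le> T"
  shows "runs (Cond b c1 c2) s T Q"
proof (cases "bval b s")
  case True
  then obtain t s' where "exec c1 s t s'" "t \<le> T'" "Q s'" using assms(1) unfolding runs_def by blast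
  then show ?thesis
    using assms(3) exec.CondTrue[OF True] unfolding runs_def by (meson add_left_mono le_trans)
next
  case False
  then obtain t s' where "exec c2 s t s'" "t \<le> T'" "Q s'" using assms(2) unfolding runs_def by blast
  then show ?thesis
    using assms(3) exec.CondFalse[OF False] unfolding runs_def by (meson add_left_mono le_trans)
qed

definition For :: "string \<Rightarrow> nat \<Rightarrow> iexp \<Rightarrow> com \<Rightarrow> com" where
  "For v lo b c = Seq (IAssign v (INum lo))
     (While (ILess (IReg v) b) (Seq c (IAssign v (IAdd (IReg v) (INum 1)))))"

lemma runs_While_up:
  assumes body: "\<And>k s. lo \<le> k \<Longrightarrow> k < hi \<Longrightarrow> reg s v = k \<Longrightarrow> J k s \<Longrightarrow>
      runs c s B (\<lambda>s'. reg s' v = k \<and> J (Suc k) (s'\<lparr>reg := (reg s')(v := Suc k)\<rparr>))"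
    and bound: "\<And>k s. J k s \<Longrightarrow> reg s v = k \<Longrightarrow> ival b s = hi"
    and "J k s" "reg s v = k" "lo \<le> k" "k \<le> hi"
  shows "runs (While (ILess (IReg v) b) (Seq c (IAssign v (IAdd (IReg v) (INum 1))))) s
      (3 + icost b + (hi - k) * (B + icost b + 7)) (\<lambda>s'. J hi s' \<and> reg s' v = hi)"
  using assms(3-6)
proof (induction "hi - k" arbitrary: k s)
  case 0
  then have "\<not> bval (ILess (IReg v) b) s" using bound by auto
  from exec.WhileFalse[OF this] 0 show ?case unfolding runs_def by fastforce
next
  case (Suc m)
  then have k: "k < hi" by simp
  obtain t s1 where e: "exec c s t s1" "t \<le> B" "reg s1 v = k"
      "J (Suc k) (s1\<lparr>reg := (reg s1)(v := Suc k)\<rparr>)"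
    using body[OF Suc.prems(3) k Suc.prems(2,1)] unfolding runs_def by blast
  let ?s2 = "s1\<lparr>reg := (reg s1)(v := Suc k)\<rparr>"
  have e2: "exec (IAssign v (IAdd (IReg v) (INum 1))) s1 4 ?s2"
    using exec.IAssign[of v "IAdd (IReg v) (INum 1)" s1] e(3) by (simp add: eval_nat_numeral)
  have m: "m = hi - Suc k" using Suc.hyps(2) by simp
  obtain t3 s3 where e3: "exec (While (ILess (IReg v) b) (Seq c (IAssign v (IAdd (IReg v) (INum 1))))) ?s2 t3 s3"
      "t3 \<le> 3 + icost b + m * (B + icost b + 7)" "J hi s3 \<and> reg s3 v = hi"
    using Suc.hyps(1)[OF m e(4)] Suc.prems(3) k m unfolding runs_def by auto
  have "bval (ILess (IReg v) b) s" using bound Suc.prems k by auto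
  note exec.WhileTrue[OF this exec.Seq[OF e(1) e2] e3(1)]
  moreover have "1 + bcost (ILess (IReg v) b) + (t + 4) + t3
      \<le> 3 + icost b + (hi - k) * (B + icost b + 7)"
    using e(2) e3(2) unfolding Suc.hyps(2)[symmetric] by simp
  ultimately show ?case using e3(3) unfolding runs_def by blast
qed

text \<open>
  The invariant is required after the update of the loop register, because it may refer to that register.
\<close>

lemma runs_For:
  assumes "J lo (s\<lparr>reg := (reg s)(v := lo)\<rparr>)" "lo \<le> hi"
    and "\<And>k s. lo \<le> k \<Longrightarrow> k < hi \<Longrightarrow> reg s v = k \<Longrightarrow> J k s \<Longrightarrow>
      runs c s B (\<lambda>s'. reg s' v = k \<and> J (Suc k) (s'\<lparr>reg := (reg s')(v := Suc k)\<rparr>))"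
    and "\<And>k s. J k s \<Longrightarrow> reg s v = k \<Longrightarrow> ival b s = hi"
    and "\<And>s. J hi s \<Longrightarrow> Q s"
    and "5 + icost b + (hi - lo) * (B + icost b + 7) \<le> T"
  shows "runs (For v lo b c) s T Q"
  unfolding For_def
proof (rule runs_Seq[where ?T1.0 = 2])
  show "runs (IAssign v (INum lo)) s 2 (\<lambda>s. runs (While (ILess (IReg v) b)
      (Seq c (IAssign v (IAdd (IReg v) (INum 1))))) s (3 + icost b + (hi - lo) * (B + icost b + 7)) Q)"
  proof (rule runs_IAssign)
    show "runs (While (ILess (IReg v) b) (Seq c (IAssign v (IAdd (IReg v) (INum 1)))))
        (s\<lparr>reg := (reg s)(v := ival (INum lo) s)\<rparr>) (3 + icost b + (hi - lo) * (B + icost b + 7)) Q"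
      by (rule runs_conseq[OF runs_While_up[where J = J and lo = lo and hi = hi and B = B and k = lo]])
        (use assms in auto)
  qed simp
  show "2 + (3 + icost b + (hi - lo) * (B + icost b + 7)) \<le> T" using assms(6) by simp
qed

text \<open>
  This frame condition keeps the specification of each part of the program local: it names
  only what the part writes, and everything else carries over to the next part.
\<close>

definition agree :: "string set \<Rightarrow> string set \<Rightarrow> ram \<Rightarrow> ram \<Rightarrow> bool" where
  "agree R A s s' \<longleftrightarrow> (\<forall>v. v \<notin> R \<longrightarrow> reg s' v = reg s v) \<and> (\<forall>a. a \<notin> A \<longrightarrow> cell s' a = cell s a)"

lemma agree_refl: "agree R A s s"
  by (simp add: agree_def)

lemma agree_reg: "agree R A s s' \<Longrightarrow> v \<notin> R \<Longrightarrow> reg s' v = reg s v"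
  by (simp add: agree_def)

lemma agree_cell: "agree R A s s' \<Longrightarrow> a \<notin> A \<Longrightarrow> cell s' a = cell s a"
  by (simp add: agree_def)

lemma agree_upd_iff:
  assumes "agree R A s s'"
  shows "agree R A s (s'\<lparr>reg := r\<rparr>) \<longleftrightarrow> (\<forall>v. v \<notin> R \<longrightarrow> r v = reg s' v)"
    and "agree R A s (s'\<lparr>cell := c\<rparr>) \<longleftrightarrow> (\<forall>a. a \<notin> A \<longrightarrow> c a = cell s' a)"
    and "agree R A s (s'\<lparr>cell := c, reg := r\<rparr>) \<longleftrightarrow>
      (\<forall>v. v \<notin> R \<longrightarrow> r v = reg s' v) \<and> (\<forall>a. a \<notin> A \<longrightarrow> c a = cell s' a)"
  using assms by (auto simp: agree_def)

lemmas agree_intros = agree_refl agree_upd_iff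

section \<open>Testing one candidate\<close>

text \<open>
  Register \<open>i\<close> holds the pivot, \<open>j\<close> the point defining the slope.  The candidate is tabulated in
  array \<open>g\<close> and its signs in \<open>sg\<close>.
\<close>

definition fill_one :: com where
  "fill_one = Seq
    (RAssign ''g'' (IReg ''m'')
      (RAdd (RCell ''Y'' (IReg ''i''))
        (RMul (RDiv (RSub (RCell ''Y'' (IReg ''j'')) (RCell ''Y'' (IReg ''i'')))
                    (RSub (RCell ''x'' (IReg ''j'')) (RCell ''x'' (IReg ''i''))))
              (RSub (RCell ''x'' (IReg ''m'')) (RCell ''x'' (IReg ''i''))))))
    (Cond (RLess (RCell ''Y'' (IReg ''m'')) (RCell ''g'' (IReg ''m'')))
      (RAssign ''sg'' (IReg ''m'') (RNum 1)) (RAssign ''sg'' (IReg ''m'') (RNum (- 1))))"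

definition fill :: com where
  "fill = For ''m'' 1 (IAdd (IReg ''n'') (INum 1)) fill_one"

lemma runs_fill:
  fixes s p q n
  defines "G \<equiv> (\<lambda>m. cell s ''Y'' p + (cell s ''Y'' q - cell s ''Y'' p) / (cell s ''x'' q - cell s ''x'' p)
      * (cell s ''x'' m - cell s ''x'' p))"
  assumes reg: "reg s ''n'' = n" "reg s ''i'' = p" "reg s ''j'' = q"
  shows "runs fill s (8 + 60 * n) (\<lambda>s'. agree {''m''} {''g'', ''sg''} s s' \<and>
    (\<forall>m\<in>{1..n}. cell s' ''g'' m = G m \<and> cell s' ''sg'' m = ereal (if G m \<le> cell s ''Y'' m then - 1 else 1)) \<and>
    (\<forall>m. m \<notin> {1..n} \<longrightarrow> cell s' ''sg'' m = cell s ''sg'' m))"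
proof -
  define J where "J = (\<lambda>k s'. agree {''m''} {''g'', ''sg''} s s' \<and>
    (\<forall>m\<in>{1..<k}. cell s' ''g'' m = G m \<and> cell s' ''sg'' m = ereal (if G m \<le> cell s ''Y'' m then - 1 else 1)) \<and>
    (\<forall>m. m \<notin> {1..<k} \<longrightarrow> cell s' ''sg'' m = cell s ''sg'' m))"
  show ?thesis
    unfolding fill_def
  proof (rule runs_For[where J = J and hi = "n + 1" and B = 50])
    show "J 1 (s\<lparr>reg := (reg s)(''m'' := 1)\<rparr>)" by (simp add: J_def agree_intros)
  next
    fix k s' assume k: "1 \<le> k" "k < n + 1" "reg s' ''m'' = k" and "J k s'"
    then have J: "agree {''m''} {''g'', ''sg''} s s'"
      "\<forall>m\<in>{1..<k}. cell s' ''g'' m = G m \<and> cell s' ''sg'' m = ereal (if G m \<le> cell s ''Y'' m then - 1 else 1)"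
      "\<forall>m. m \<notin> {1..<k} \<longrightarrow> cell s' ''sg'' m = cell s ''sg'' m" by (simp_all add: J_def)
    have r: "reg s' ''n'' = n" "reg s' ''i'' = p" "reg s' ''j'' = q"
        "cell s' ''x'' = cell s ''x''" "cell s' ''Y'' = cell s ''Y''"
      using agree_reg[OF J(1)] agree_cell[OF J(1)] reg by simp_all
    show "runs fill_one s' 50
        (\<lambda>s'. reg s' ''m'' = k \<and> J (Suc k) (s'\<lparr>reg := (reg s')(''m'' := Suc k)\<rparr>))"
      unfolding fill_one_def
      apply (rule runs_Seq[where ?T1.0 = 30 and ?T2.0 = 20])
       apply (rule runs_RAssign)
        apply (simp)
       apply (rule runs_Cond[where T' = 10])
         apply (rule runs_RAssign)
          apply simp
      subgoal using k r J(2,3) by (auto simp: J_def agree_intros J(1) G_def less_Suc_eq not_less)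
        apply (rule runs_RAssign)
         apply simp
      subgoal using k r J(2,3) by (auto simp: J_def agree_intros J(1) G_def less_Suc_eq not_less)
      by simp_all
  next
    fix k s' assume "J k s'"
    then have "agree {''m''} {''g'', ''sg''} s s'" by (simp add: J_def)
    then show "ival (IAdd (IReg ''n'') (INum 1)) s' = n + 1"
      using agree_reg[of "{''m''}" "{''g'', ''sg''}" s s' "''n''"] reg by simp
  qed (auto simp: J_def)
qed

text \<open>
  The local statistics at distance up to \<open>n\<close> look at the sequence up to index \<open>2 n\<close>.
  No case distinction at \<open>n\<close> is needed because array \<open>sg\<close> is zero outside \<open>{1..n}\<close>.
\<close>

definition accumulate :: com where
  "accumulate = For ''m'' 0 (IAdd (IReg ''n'') (IReg ''n''))
    (RAssign ''Q'' (IAdd (IReg ''m'') (INum 1))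
      (RAdd (RSub (RMul (RNum 2) (RCell ''Q'' (IReg ''m'')))
                  (RCell ''Q'' (ISub (IReg ''m'') (INum 1))))
            (RCell ''sg'' (IReg ''m''))))"

lemma runs_accumulate:
  assumes reg: "reg s ''n'' = n" and Q0: "cell s ''Q'' 0 = 0"
    and sg: "\<And>m. m \<in> {1..n} \<Longrightarrow> cell s ''sg'' m = ereal (\<sigma> m)" "\<And>m. m \<notin> {1..n} \<Longrightarrow> cell s ''sg'' m = 0"
  shows "runs accumulate s (10 + 80 * n) (\<lambda>s'. agree {''m''} {''Q''} s s' \<and>
    (\<forall>m\<le>n + n. cell s' ''Q'' m = ereal (ramp_sum n \<sigma> m)))"
proof -
  define J where "J = (\<lambda>k s'. agree {''m''} {''Q''} s s' \<and>
    (\<forall>m\<le>k. cell s' ''Q'' m = ereal (ramp_sum n \<sigma> m)))"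
  show ?thesis
    unfolding accumulate_def
  proof (rule runs_For[where J = J and hi = "n + n" and B = 30])
    show "J 0 (s\<lparr>reg := (reg s)(''m'' := 0)\<rparr>)"
      using Q0 by (simp add: J_def agree_intros ramp_sum_0 zero_ereal_def)
  next
    fix k s' assume k: "k < n + n" "reg s' ''m'' = k" and "J k s'"
    then have J: "agree {''m''} {''Q''} s s'" "\<forall>m\<le>k. cell s' ''Q'' m = ereal (ramp_sum n \<sigma> m)"
      by (simp_all add: J_def)
    have "cell s' ''sg'' k = ereal (if k \<in> {1..n} then \<sigma> k else 0)"
      using agree_cell[OF J(1)] sg by (simp add: zero_ereal_def)
    then have "ereal 2 * cell s' ''Q'' k - cell s' ''Q'' (k - 1) + cell s' ''sg'' k
        = ereal (ramp_sum n \<sigma> (Suc k))"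
      using J(2) by (simp add: ramp_sum_Suc)
    then show "runs (RAssign ''Q'' (IAdd (IReg ''m'') (INum 1))
      (RAdd (RSub (RMul (RNum 2) (RCell ''Q'' (IReg ''m'')))
                  (RCell ''Q'' (ISub (IReg ''m'') (INum 1))))
            (RCell ''sg'' (IReg ''m'')))) s' 30
        (\<lambda>s'. reg s' ''m'' = k \<and> J (Suc k) (s'\<lparr>reg := (reg s')(''m'' := Suc k)\<rparr>))"
      apply (intro runs_RAssign)
      using k J(2) by (auto simp: J_def agree_intros J(1) le_Suc_eq)
  next
    fix k s' assume "J k s'"
    then have "agree {''m''} {''Q''} s s'" by (simp add: J_def)
    then show "ival (IAdd (IReg ''n'') (IReg ''n'')) s' = n + n"
      using agree_reg[of "{''m''}" "{''Q''}" s s' "''n''"] reg by simp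
  qed (auto simp: J_def)
qed

text \<open>
  The scale factor has the closed form of \<open>beta_scale_eq\<close>, and \<open>ln (exp 1 / u)\<close> is computed as \<open>1 + ln (1 / u)\<close>,
  which avoids the constant \<open>exp 1\<close>.
\<close>

definition stat_exp :: rexp where
  "stat_exp = (let d = IReg ''d''; c = IReg ''c''; rd = ROfIdx d in
    RSub
      (RMul (RDiv (RDiv (RNum 1)
              (RSqrt (RDiv (RAdd (RMul (RMul (RNum 2) rd) rd) (RNum 1)) (RMul (RNum 3) rd)))) rd)
        (RSub (RAdd (RCell ''Q'' (IAdd c d)) (RCell ''Q'' (ISub c d))) (RMul (RNum 2) (RCell ''Q'' c))))
      (RSqrt (RMul (RNum 2) (RAdd (RNum 1)
        (RLn (RDiv (ROfIdx (IReg ''n'')) (RSub (RMul (RNum 2) rd) (RNum 1))))))))"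

lemma ext_sqrt_ereal: "0 \<le> r \<Longrightarrow> ext_sqrt (ereal r) = ereal (sqrt r)"
  by (simp add: ext_sqrt_def zero_ereal_def)

lemma ext_ln_ereal: "r > 0 \<Longrightarrow> ext_ln (ereal r) = ereal (ln r)"
  by (simp add: ext_ln_def zero_ereal_def)

lemma rval_stat_exp:
  assumes Q: "\<And>m. m \<le> n + n \<Longrightarrow> cell s ''Q'' m = ereal (ramp_sum n \<sigma> m)"
    and reg: "reg s ''n'' = n" "reg s ''d'' = d" "reg s ''c'' = j"
    and d: "1 \<le> d" "2 * d \<le> n + 1" and j: "1 \<le> j" "j \<le> n"
  shows "rval stat_exp s = ereal (T_loc n d j \<sigma> - Gam ((2 * real d - 1) / real n))"
proof -
  have Qs: "cell s ''Q'' (j + d) = ereal (ramp_sum n \<sigma> (j + d))"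
      "cell s ''Q'' (j - d) = ereal (ramp_sum n \<sigma> (j - d))" "cell s ''Q'' j = ereal (ramp_sum n \<sigma> j)"
    using d j by (auto intro!: Q)
  have pos: "(2 * real d * real d + 1) / (3 * real d) > 0" using d by (simp add: field_simps add_pos_pos)
  have nz: "2 * real d * real d + 1 \<noteq> 0"
    using mult_nonneg_nonneg[of "2 * real d" "real d"] by linarith
  have n: "real n > 0" "2 * real d - 1 \<ge> 1" "2 * real d - 1 \<le> real n" using d by auto
  then have ge1: "1 \<le> real n / (2 * real d - 1)" by simp
  have "rval (RDiv (RNum 1) (RSqrt (RDiv (RAdd (RMul (RMul (RNum 2) (ROfIdx (IReg ''d''))) (ROfIdx (IReg ''d'')))
      (RNum 1)) (RMul (RNum 3) (ROfIdx (IReg ''d'')))))) s = ereal (beta_scale d)"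
    using pos nz d by (simp add: reg beta_scale_eq ext_sqrt_ereal not_le)
  moreover have "rval (RSqrt (RMul (RNum 2) (RAdd (RNum 1)
        (RLn (RDiv (ROfIdx (IReg ''n'')) (RSub (RMul (RNum 2) (ROfIdx (IReg ''d''))) (RNum 1))))))) s
      = ereal (Gam ((2 * real d - 1) / real n))"
  proof -
    define l where "l = ln (real n / (2 * real d - 1))"
    have "ext_ln (ereal (real n) / ereal (2 * real d - 1)) = ereal l"
      using n ge1 by (simp add: ext_ln_ereal l_def)
    moreover have "0 \<le> l" using ge1 by (simp add: l_def)
    moreover have "Gam ((2 * real d - 1) / real n) = sqrt (2 * (1 + l))"
      unfolding l_def using d by (rule Gam_eq)
    ultimately show ?thesis by (simp add: reg ext_sqrt_ereal)
  qed
  ultimately show ?thesis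
    unfolding stat_exp_def Let_def T_loc_eq_ramp_sum[OF d(1)]
    using d by (simp add: Qs reg)
qed

text \<open>
  The language cannot halve \<open>n + 1\<close>, so \<open>d\<close> runs up to \<open>n\<close> and the test \<open>d + d < n + 2\<close> skips the excess.
\<close>

definition check_one :: com where
  "check_one = Cond (BAnd (ILess (IAdd (IReg ''d'') (IReg ''d'')) (IAdd (IReg ''n'') (INum 2)))
                          (RLess (RCell ''kappa'' (INum 0)) stat_exp))
    (RAssign ''ok'' (INum 0) (RNum 0)) Skip"

definition check :: com where
  "check = Seq (RAssign ''ok'' (INum 0) (RNum 1))
    (For ''d'' 1 (IAdd (IReg ''n'') (INum 1)) (For ''c'' 1 (IAdd (IReg ''n'') (INum 1)) check_one))"

lemma runs_check:
  assumes reg: "reg s ''n'' = n" and n: "n \<ge> 1" and kappa: "cell s ''kappa'' 0 = ereal K"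
    and Q: "\<And>m. m \<le> n + n \<Longrightarrow> cell s ''Q'' m = ereal (ramp_sum n \<sigma> m)"
  shows "runs check s (100 * (n + 1)\<^sup>2) (\<lambda>s'. agree {''d'', ''c''} {''ok''} s s' \<and>
    cell s' ''ok'' 0 = (if T_o n \<sigma> \<le> K then 1 else 0))"
proof -
  define F where "F = (\<lambda>d j. 2 * d \<le> n + 1 \<longrightarrow> T_loc n d j \<sigma> - Gam ((2 * real d - 1) / real n) \<le> K)"
  define J where "J = (\<lambda>d s'. agree {''d'', ''c''} {''ok''} s s' \<and>
    cell s' ''ok'' 0 = (if \<forall>d'\<in>{1..<d}. \<forall>j\<in>{1..n}. F d' j then 1 else 0))"
  define I where "I = (\<lambda>d c s'. agree {''d'', ''c''} {''ok''} s s' \<and> reg s' ''d'' = d \<and>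
    cell s' ''ok'' 0 = (if (\<forall>d'\<in>{1..<d}. \<forall>j\<in>{1..n}. F d' j) \<and> (\<forall>j\<in>{1..<c}. F d j) then 1 else 0))"
  have T: "T_o n \<sigma> \<le> K \<longleftrightarrow> (\<forall>d\<in>{1..<n + 1}. \<forall>j\<in>{1..n}. F d j)"
  proof -
    have "d \<in> {1..(n + 1) div 2} \<longleftrightarrow> d \<in> {1..<n + 1} \<and> 2 * d \<le> n + 1" for d
      using n by auto
    then show ?thesis unfolding T_o_le_iff[OF n] F_def by blast
  qed
  have bound: "ival (IAdd (IReg ''n'') (INum 1)) s' = n + 1" if "agree {''d'', ''c''} {''ok''} s s'" for s'
    using agree_reg[OF that, of "''n''"] reg by simp
  have step: "runs check_one s' 75
      (\<lambda>s'. reg s' ''c'' = c \<and> I d (Suc c) (s'\<lparr>reg := (reg s')(''c'' := Suc c)\<rparr>))"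
    if d: "1 \<le> d" "d < n + 1" and c: "1 \<le> c" "c < n + 1" "reg s' ''c'' = c" and IH: "I d c s'" for d c s'
  proof -
    have a: "agree {''d'', ''c''} {''ok''} s s'" and rd: "reg s' ''d'' = d"
      and ok: "cell s' ''ok'' 0 = (if (\<forall>d'\<in>{1..<d}. \<forall>j\<in>{1..n}. F d' j) \<and> (\<forall>j\<in>{1..<c}. F d j) then 1 else 0)"
      using IH by (simp_all add: I_def)
    have r: "reg s' ''n'' = n" "cell s' ''kappa'' 0 = ereal K" "cell s' ''Q'' = cell s ''Q''"
      using agree_reg[OF a] agree_cell[OF a] reg kappa by simp_all
    have "rval stat_exp s' = ereal (T_loc n d c \<sigma> - Gam ((2 * real d - 1) / real n))" if "2 * d \<le> n + 1"
      by (rule rval_stat_exp) (use r rd c d that Q in auto)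
    then have b: "bval (BAnd (ILess (IAdd (IReg ''d'') (IReg ''d'')) (IAdd (IReg ''n'') (INum 2)))
                    (RLess (RCell ''kappa'' (INum 0)) stat_exp)) s' \<longleftrightarrow> \<not> F d c"
      using r rd by (auto simp: F_def)
    have split: "(\<forall>j\<in>{1..<Suc c}. F d j) \<longleftrightarrow> (\<forall>j\<in>{1..<c}. F d j) \<and> F d c"
      using c by (auto simp: less_Suc_eq)
    show ?thesis
      unfolding check_one_def
    proof (rule runs_Cond[where T' = 4])
      assume "bval (BAnd (ILess (IAdd (IReg ''d'') (IReg ''d'')) (IAdd (IReg ''n'') (INum 2)))
                    (RLess (RCell ''kappa'' (INum 0)) stat_exp)) s'"
      then show "runs (RAssign ''ok'' (INum 0) (RNum 0)) s' 4
          (\<lambda>s'. reg s' ''c'' = c \<and> I d (Suc c) (s'\<lparr>reg := (reg s')(''c'' := Suc c)\<rparr>))"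
        unfolding b by (intro runs_RAssign) (auto simp: I_def split split[unfolded One_nat_def] agree_intros a rd c zero_ereal_def simp del: atLeastLessThan_iff)
    next
      assume "\<not> bval (BAnd (ILess (IAdd (IReg ''d'') (IReg ''d'')) (IAdd (IReg ''n'') (INum 2)))
                    (RLess (RCell ''kappa'' (INum 0)) stat_exp)) s'"
      then show "runs Skip s' 4 
          (\<lambda>s'. reg s' ''c'' = c \<and> I d (Suc c) (s'\<lparr>reg := (reg s')(''c'' := Suc c)\<rparr>))"
        unfolding b by (intro runs_Skip) (auto simp: I_def split split[unfolded One_nat_def] agree_intros a rd c ok simp del: atLeastLessThan_iff)
    qed (simp add: stat_exp_def Let_def)
  qed
  show ?thesis
    unfolding check_def
  proof (rule runs_Seq[where ?T1.0 = 3 and ?T2.0 = "8 + n * ((8 + n * 85) + 10)"])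
    show "runs (RAssign ''ok'' (INum 0) (RNum 1)) s 3 (\<lambda>s1. runs (For ''d'' 1 (IAdd (IReg ''n'') (INum 1))
      (For ''c'' 1 (IAdd (IReg ''n'') (INum 1))
        check_one)) s1 (8 + n * ((8 + n * 85) + 10))
        (\<lambda>s'. agree {''d'', ''c''} {''ok''} s s' \<and> cell s' ''ok'' 0 = (if T_o n \<sigma> \<le> K then 1 else 0)))"
    proof (rule runs_RAssign, simp, rule runs_For[where J = J and hi = "n + 1" and B = "8 + n * 85"])
      fix d s' assume d: "1 \<le> d" "d < n + 1" "reg s' ''d'' = d" "J d s'"
      show "runs (For ''c'' 1 (IAdd (IReg ''n'') (INum 1))
        check_one) s' (8 + n * 85)
        (\<lambda>s'. reg s' ''d'' = d \<and> J (Suc d) (s'\<lparr>reg := (reg s')(''d'' := Suc d)\<rparr>))"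
      proof (rule runs_For[where J = "I d" and hi = "n + 1" and B = 75])
        show "I d 1 (s'\<lparr>reg := (reg s')(''c'' := 1)\<rparr>)" using d by (auto simp: I_def J_def agree_intros)
      next
        fix s1 assume "I d (n + 1) s1"
        moreover have "{1..<n + 1} = {1..n}" "{1..<Suc d} = insert d {1..<d}" using d by auto
        ultimately show "reg s1 ''d'' = d \<and> J (Suc d) (s1\<lparr>reg := (reg s1)(''d'' := Suc d)\<rparr>)"
          by (auto simp: I_def J_def agree_intros simp del: atLeastLessThan_iff)
      next
        fix c s'
        assume "1 \<le> c" "c < n + 1" "reg s' ''c'' = c" "I d c s'"
        with d show "runs check_one s' 75
            (\<lambda>s'. reg s' ''c'' = c \<and> I d (Suc c) (s'\<lparr>reg := (reg s')(''c'' := Suc c)\<rparr>))"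
          by (intro step)
      next
        fix c s' assume "I d c s'"
        then show "ival (IAdd (IReg ''n'') (INum 1)) s' = n + 1" by (intro bound) (simp add: I_def)
      qed simp_all
    qed (use bound in \<open>auto simp: J_def agree_intros T\<close>)
    show "3 + (8 + n * ((8 + n * 85) + 10)) \<le> 100 * (n + 1)\<^sup>2"
      by (simp add: power2_eq_square algebra_simps)
  qed
qed

definition update_one :: com where
  "update_one = Cond (RLess (RCell ''U'' (IReg ''m'')) (RCell ''g'' (IReg ''m'')))
    (RAssign ''U'' (IReg ''m'') (RCell ''g'' (IReg ''m''))) Skip"

definition update :: com where
  "update = Cond (RLess (RNum 0) (RCell ''ok'' (INum 0)))
    (For ''m'' 1 (IAdd (IReg ''n'') (INum 1)) update_one) Skip"

lemma runs_update:
  assumes reg: "reg s ''n'' = n" and ok: "cell s ''ok'' 0 = (if P then 1 else 0)"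
  shows "runs update s (14 + 30 * n) (\<lambda>s'. agree {''m''} {''U''} s s' \<and>
    (\<forall>m\<in>{1..n}. cell s' ''U'' m = (if P then max (cell s ''U'' m) (cell s ''g'' m) else cell s ''U'' m)))"
proof -
  define J where "J = (\<lambda>k s'. agree {''m''} {''U''} s s' \<and>
    (\<forall>m. cell s' ''U'' m = (if m \<in> {1..<k} then max (cell s ''U'' m) (cell s ''g'' m) else cell s ''U'' m)))"
  show ?thesis
    unfolding update_def
  proof (rule runs_Cond[where T' = "8 + 30 * n"])
    assume "bval (RLess (RNum 0) (RCell ''ok'' (INum 0))) s"
    then have P: P using ok by (auto split: if_splits)
    show "runs (For ''m'' 1 (IAdd (IReg ''n'') (INum 1))
      update_one) s (8 + 30 * n)
      (\<lambda>s'. agree {''m''} {''U''} s s' \<and>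
        (\<forall>m\<in>{1..n}. cell s' ''U'' m = (if P then max (cell s ''U'' m) (cell s ''g'' m) else cell s ''U'' m)))"
    proof (rule runs_For[where J = J and hi = "n + 1" and B = 20])
      fix k s' assume k: "1 \<le> k" "k < n + 1" "reg s' ''m'' = k" and "J k s'"
      then have J: "agree {''m''} {''U''} s s'"
        "\<And>m. cell s' ''U'' m = (if m \<in> {1..<k} then max (cell s ''U'' m) (cell s ''g'' m) else cell s ''U'' m)"
        by (simp_all add: J_def)
      have g: "cell s' ''g'' = cell s ''g''" using agree_cell[OF J(1)] by simp
      show "runs update_one s' 20
        (\<lambda>s'. reg s' ''m'' = k \<and> J (Suc k) (s'\<lparr>reg := (reg s')(''m'' := Suc k)\<rparr>))"
        unfolding update_one_def
      proof (rule runs_Cond[where T' = 10])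
        assume "bval (RLess (RCell ''U'' (IReg ''m'')) (RCell ''g'' (IReg ''m''))) s'"
        then show "runs (RAssign ''U'' (IReg ''m'') (RCell ''g'' (IReg ''m''))) s' 10
          (\<lambda>s'. reg s' ''m'' = k \<and> J (Suc k) (s'\<lparr>reg := (reg s')(''m'' := Suc k)\<rparr>))"
          using k by (intro runs_RAssign) (auto simp: J_def J agree_intros g less_Suc_eq max_def)
      next
        assume "\<not> bval (RLess (RCell ''U'' (IReg ''m'')) (RCell ''g'' (IReg ''m''))) s'"
        then show "runs Skip s' 10
          (\<lambda>s'. reg s' ''m'' = k \<and> J (Suc k) (s'\<lparr>reg := (reg s')(''m'' := Suc k)\<rparr>))"
          using k by (intro runs_Skip) (auto simp: J_def J agree_intros g less_Suc_eq max_def)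
      qed simp
    next
      fix k s' assume "J k s'"
    then have "agree {''m''} {''U''} s s'" by (simp add: J_def)
    then show "ival (IAdd (IReg ''n'') (INum 1)) s' = n + 1"
      using agree_reg[of "{''m''}" "{''U''}" s s' "''n''"] reg by simp
    qed (auto simp: J_def agree_intros P)
  next
    assume "\<not> bval (RLess (RNum 0) (RCell ''ok'' (INum 0))) s"
    then have "\<not> P" using ok by (auto split: if_splits)
    then show "runs Skip s (8 + 30 * n) (\<lambda>s'. agree {''m''} {''U''} s s' \<and>
        (\<forall>m\<in>{1..n}. cell s' ''U'' m = (if P then max (cell s ''U'' m) (cell s ''g'' m) else cell s ''U'' m)))"
      by (intro runs_Skip) (auto simp: agree_intros)
  qed simp
qed

text \<open>
  The invariant under which a candidate can be tried: besides the augmented data, it records the zeros on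
  which \<open>accumulate\<close> relies.
\<close>

definition ram_ready :: "nat \<Rightarrow> (nat \<Rightarrow> real) \<Rightarrow> (nat \<Rightarrow> real) \<Rightarrow> real \<Rightarrow> ram \<Rightarrow> bool" where
  "ram_ready n x Y K s \<longleftrightarrow> reg s ''n'' = n \<and> cell s ''kappa'' 0 = ereal K \<and>
     (\<forall>p\<le>n + 1. cell s ''x'' p = ereal (node_x n x p) \<and> cell s ''Y'' p = node_y n Y p) \<and>
     (\<forall>m. m \<notin> {1..n} \<longrightarrow> cell s ''sg'' m = 0) \<and> cell s ''Q'' 0 = 0"

definition try_cand :: com where
  "try_cand = Seq fill (Seq accumulate (Seq check update))"

text \<open>
  The check dominates with \<open>O(n\<^sup>2)\<close> steps; the remaining parts are linear.
\<close>

lemma runs_try_cand: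
  assumes n: "n \<ge> 1" and ready: "ram_ready n x Y K s"
    and reg: "reg s ''i'' = p" "reg s ''j'' = q" and pq: "p \<le> n" "q \<le> n + 1"
  shows "runs try_cand s (300 * (n + 1)\<^sup>2) (\<lambda>s'. ram_ready n x Y K s' \<and>
    reg s' ''i'' = p \<and> reg s' ''j'' = q \<and>
    (\<forall>m\<in>{1..n}. cell s' ''U'' m = (if feasible n x Y K (cand n x Y (p, q))
       then max (cell s ''U'' m) (cand n x Y (p, q) (x m)) else cell s ''U'' m)))"
proof -
  define \<sigma> where "\<sigma> = (\<lambda>m. sgn_low (cand n x Y (p, q) (x m) - ereal (Y m)))"
  define Q1 where "Q1 = (\<lambda>s1. agree {''m''} {''g'', ''sg''} s s1 \<and>
    (\<forall>m\<in>{1..n}. cell s1 ''g'' m = cand n x Y (p, q) (x m) \<and> cell s1 ''sg'' m = ereal (\<sigma> m)) \<and>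
    (\<forall>m. m \<notin> {1..n} \<longrightarrow> cell s1 ''sg'' m = 0))"
  define Q2 where "Q2 = (\<lambda>s1 s2. agree {''m''} {''Q''} s1 s2 \<and>
    (\<forall>m\<le>n + n. cell s2 ''Q'' m = ereal (ramp_sum n \<sigma> m)))"
  define Q3 where "Q3 = (\<lambda>s2 s3. agree {''d'', ''c''} {''ok''} s2 s3 \<and>
    cell s3 ''ok'' 0 = (if T_o n \<sigma> \<le> K then 1 else 0))"
  define Q4 where "Q4 = (\<lambda>s3 s4. agree {''m''} {''U''} s3 s4 \<and>
    (\<forall>m\<in>{1..n}. cell s4 ''U'' m = (if T_o n \<sigma> \<le> K
       then max (cell s3 ''U'' m) (cell s3 ''g'' m) else cell s3 ''U'' m)))"
  have r: "reg s ''n'' = n" "cell s ''kappa'' 0 = ereal K" "cell s ''Q'' 0 = 0"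
      "\<And>m. m \<notin> {1..n} \<Longrightarrow> cell s ''sg'' m = 0"
      "\<And>p. p \<le> n + 1 \<Longrightarrow> cell s ''x'' p = ereal (node_x n x p)"
      "\<And>p. p \<le> n + 1 \<Longrightarrow> cell s ''Y'' p = node_y n Y p"
    using ready by (simp_all add: ram_ready_def)
  have points: "node_x n x m = x m" "node_y n Y m = ereal (Y m)" if "m \<in> {1..n}" for m
    using that by (auto simp: node_x_def node_y_def)
  have 1: "runs fill s (8 + 60 * n) Q1"
    by (rule runs_conseq[OF runs_fill[OF r(1) reg]])
      (use pq in \<open>auto simp: Q1_def r cand_def line_def points \<sigma>_def sgn_low_minus_ereal\<close>)
  have 2: "runs accumulate s1 (10 + 80 * n) (Q2 s1)" if "Q1 s1" for s1
    unfolding Q2_def using that r by (intro runs_accumulate) (auto simp: Q1_def agree_def)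
  have 3: "runs check s2 (100 * (n + 1)\<^sup>2) (Q3 s2)" if "Q1 s1" "Q2 s1 s2" for s1 s2
    unfolding Q3_def using that r n by (intro runs_check) (auto simp: Q1_def Q2_def agree_def)
  have 4: "runs update s3 (14 + 30 * n) (Q4 s3)" if "Q1 s1" "Q2 s1 s2" "Q3 s2 s3" for s1 s2 s3
    unfolding Q4_def using that r by (intro runs_update) (auto simp: Q1_def Q2_def Q3_def agree_def)
  have post: "ram_ready n x Y K s4 \<and> reg s4 ''i'' = p \<and> reg s4 ''j'' = q \<and>
    (\<forall>m\<in>{1..n}. cell s4 ''U'' m = (if feasible n x Y K (cand n x Y (p, q))
       then max (cell s ''U'' m) (cand n x Y (p, q) (x m)) else cell s ''U'' m))"
    if q: "Q1 s1" "Q2 s1 s2" "Q3 s2 s3" "Q4 s3 s4" for s1 s2 s3 s4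
  proof -
    have ag: "agree {''m''} {''g'', ''sg''} s s1" "agree {''m''} {''Q''} s1 s2"
        "agree {''d'', ''c''} {''ok''} s2 s3" "agree {''m''} {''U''} s3 s4"
      using q by (simp_all add: Q1_def Q2_def Q3_def Q4_def)
    have regs: "reg s4 v = reg s v" if "v \<notin> {''m'', ''d'', ''c''}" for v
      using that ag by (simp add: agree_def)
    have cells: "cell s4 a = cell s a" if "a \<notin> {''g'', ''sg'', ''Q'', ''ok'', ''U''}" for a
      using that ag by (simp add: agree_def)
    have sg: "cell s4 ''sg'' = cell s1 ''sg''" and Q: "cell s4 ''Q'' = cell s2 ''Q''"
      and U: "cell s3 ''U'' = cell s ''U''" and g: "cell s3 ''g'' = cell s1 ''g''"
      using ag by (simp_all add: agree_def)
    have "ram_ready n x Y K s4"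
      using q(1,2) by (simp add: ram_ready_def regs cells sg Q r Q1_def Q2_def ramp_sum_0 zero_ereal_def)
    moreover have "feasible n x Y K (cand n x Y (p, q)) \<longleftrightarrow> T_o n \<sigma> \<le> K"
      by (simp add: feasible_def \<sigma>_def)
    ultimately show ?thesis
      using q(1,4) by (simp add: regs reg U g Q1_def Q4_def)
  qed
  show ?thesis
    unfolding try_cand_def
  proof (rule runs_Seq[where ?T1.0 = "8 + 60 * n" and ?T2.0 = "10 + 80 * n + (100 * (n + 1)\<^sup>2 + (14 + 30 * n))"])
    show "8 + 60 * n + (10 + 80 * n + (100 * (n + 1)\<^sup>2 + (14 + 30 * n))) \<le> 300 * (n + 1)\<^sup>2"
      by (simp add: power2_eq_square algebra_simps)
  qed (rule runs_conseq[OF 1 order_refl],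
    rule runs_Seq[OF runs_conseq[OF 2 order_refl] order_refl], assumption,
    rule runs_Seq[OF runs_conseq[OF 3 order_refl] order_refl], assumption+,
    rule runs_conseq[OF 4 order_refl], assumption+, rule post, assumption+)
qed

section \<open>The whole program\<close>

text \<open>
  Infinite values are obtained from \<open>ln 0\<close>.  The bound starts as \<open>- \<infinity>\<close>, the supremum over the empty set.
\<close>

definition init :: com where
  "init =
    Seq (RAssign ''x'' (INum 0) (RSub (RCell ''x'' (INum 1)) (RNum 1)))
    (Seq (RAssign ''x'' (IAdd (IReg ''n'') (INum 1)) (RAdd (RCell ''x'' (IReg ''n'')) (RNum 1)))
    (Seq (RAssign ''Y'' (INum 0) (RSub (RNum 0) (RLn (RNum 0))))
    (Seq (RAssign ''Y'' (IAdd (IReg ''n'') (INum 1)) (RSub (RNum 0) (RLn (RNum 0))))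
      (For ''m'' 1 (IAdd (IReg ''n'') (INum 1)) (RAssign ''U'' (IReg ''m'') (RLn (RNum 0)))))))"

lemma runs_init:
  assumes n: "n \<ge> 1"
  shows "runs init (ram_input n x Y K) (60 + 20 * n) (\<lambda>s. ram_ready n x Y K s \<and>
    (\<forall>m\<in>{1..n}. cell s ''U'' m = - \<infinity>))"
proof -
  have ln0: "rval (RLn (RNum 0)) s = - \<infinity>" for s by (simp add: ext_ln_def zero_ereal_def)
  define J where "J = (\<lambda>k s. ram_ready n x Y K s \<and> (\<forall>m\<in>{1..<k}. cell s ''U'' m = - \<infinity>))"
  have loop: "runs (For ''m'' 1 (IAdd (IReg ''n'') (INum 1)) (RAssign ''U'' (IReg ''m'') (RLn (RNum 0)))) s
      (8 + 20 * n) (\<lambda>s. ram_ready n x Y K s \<and> (\<forall>m\<in>{1..n}. cell s ''U'' m = - \<infinity>))"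
    if "ram_ready n x Y K s" for s
  proof (rule runs_For[where J = J and hi = "n + 1" and B = 5])
    fix k s assume "1 \<le> k" "k < n + 1" "reg s ''m'' = k" "J k s"
    then show "runs (RAssign ''U'' (IReg ''m'') (RLn (RNum 0))) s 5
        (\<lambda>s'. reg s' ''m'' = k \<and> J (Suc k) (s'\<lparr>reg := (reg s')(''m'' := Suc k)\<rparr>))"
      by (intro runs_RAssign) (auto simp: J_def ram_ready_def ln0 less_Suc_eq simp del: rval.simps(9))
  qed (use that in \<open>auto simp: J_def ram_ready_def\<close>)
  show ?thesis
    unfolding init_def
    apply (rule runs_Seq[where ?T1.0 = 10 and ?T2.0 = "50 + 20 * n"])
     apply (rule runs_RAssign, simp)
     apply (rule runs_Seq[where ?T1.0 = 10 and ?T2.0 = "40 + 20 * n"])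
      apply (rule runs_RAssign, simp)
      apply (rule runs_Seq[where ?T1.0 = 10 and ?T2.0 = "30 + 20 * n"])
       apply (rule runs_RAssign, simp)
       apply (rule runs_Seq[where ?T1.0 = 10 and ?T2.0 = "8 + 20 * n"])
        apply (rule runs_RAssign, simp)
        apply (rule loop)
    using n by (auto simp: ram_ready_def ram_input_def node_x_def node_y_def ext_ln_def)
qed

definition band_program :: com where
  "band_program = Seq init
    (For ''i'' 0 (IAdd (IReg ''n'') (INum 1)) (For ''j'' 0 (IAdd (IReg ''n'') (INum 2)) try_cand))"

lemma best_empty: "best n x Y k {} t = - \<infinity>"
  by (simp add: best_def bot_ereal_def)

lemma best_insert:
  "best n x Y k (insert pq A) t = (if feasible n x Y k (cand n x Y pq)
     then max (best n x Y k A t) (cand n x Y pq t) else best n x Y k A t)"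
proof -
  have "{r\<in>insert pq A. feasible n x Y k (cand n x Y r)} = (if feasible n x Y k (cand n x Y pq)
      then insert pq {r\<in>A. feasible n x Y k (cand n x Y r)} else {r\<in>A. feasible n x Y k (cand n x Y r)})"
    by auto
  then show ?thesis by (simp add: best_def sup_max max.commute)
qed

lemma runs_band_program:
  assumes n: "n \<ge> 1"
  shows "runs band_program (ram_input n x Y K) (1000 * (n + 2) ^ 4)
    (\<lambda>s. \<forall>m\<in>{1..n}. cell s ''U'' m = best n x Y K ({..n} \<times> {..n + 1}) (x m))"
proof -
  define I where "I = (\<lambda>A s. ram_ready n x Y K s \<and> (\<forall>m\<in>{1..n}. cell s ''U'' m = best n x Y K A (x m)))"
  have I_reg: "I A (s\<lparr>reg := (reg s)(v := k)\<rparr>) \<longleftrightarrow> I A s" if "v \<noteq> ''n''" for A s v k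
    using that by (simp add: I_def ram_ready_def)
  have bound: "reg s ''n'' = n" if "I A s" for A s using that by (simp add: I_def ram_ready_def)
  define R where "R = (\<lambda>p::nat. {..<p} \<times> {..<n + 2})"
  define RJ where "RJ = (\<lambda>p q. R p \<union> {p} \<times> {..<q})"
  have sets: "RJ p 0 = R p" "RJ p (n + 2) = R (Suc p)" "RJ p (Suc q) = insert (p, q) (RJ p q)" for p q
    by (auto simp: R_def RJ_def less_Suc_eq)
  have step: "runs try_cand s (300 * (n + 1)\<^sup>2)
      (\<lambda>s'. reg s' ''j'' = q \<and> reg s' ''i'' = p \<and> I (RJ p (Suc q)) s')"
    if "p < n + 1" "q < n + 2" "reg s ''i'' = p" "reg s ''j'' = q" "I (RJ p q) s" for p q s
  proof -
    have "runs try_cand s (300 * (n + 1)\<^sup>2) (\<lambda>s'. ram_ready n x Y K s' \<and>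
      reg s' ''i'' = p \<and> reg s' ''j'' = q \<and>
      (\<forall>m\<in>{1..n}. cell s' ''U'' m = (if feasible n x Y K (cand n x Y (p, q))
       then max (cell s ''U'' m) (cand n x Y (p, q) (x m)) else cell s ''U'' m)))"
      using that by (intro runs_try_cand n) (auto simp: I_def)
    then show ?thesis
      by (rule runs_conseq) (use that(5) in \<open>auto simp: I_def sets best_insert\<close>)
  qed
  have row: "runs (For ''j'' 0 (IAdd (IReg ''n'') (INum 2)) try_cand) s
      (8 + (n + 2) * (300 * (n + 1)\<^sup>2 + 10)) (\<lambda>s'. reg s' ''i'' = p \<and> I (R (Suc p)) s')"
    if "p < n + 1" "reg s ''i'' = p" "I (R p) s" for p s
  proof (rule runs_For[where J = "\<lambda>q s. reg s ''i'' = p \<and> I (RJ p q) s" and hi = "n + 2"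
        and B = "300 * (n + 1)\<^sup>2"])
    fix q s assume "q < n + 2" "reg s ''j'' = q" "reg s ''i'' = p \<and> I (RJ p q) s"
    then show "runs try_cand s (300 * (n + 1)\<^sup>2) (\<lambda>s'. reg s' ''j'' = q \<and>
        reg (s'\<lparr>reg := (reg s')(''j'' := Suc q)\<rparr>) ''i'' = p \<and>
        I (RJ p (Suc q)) (s'\<lparr>reg := (reg s')(''j'' := Suc q)\<rparr>))"
      using step[OF that(1), of q s] by (simp add: I_reg conj_commute)
  qed (use that bound sets in \<open>auto simp: I_reg\<close>)
  have all: "R (n + 1) = {..n} \<times> {..n + 1}" by (auto simp: R_def)
  show ?thesis
    unfolding band_program_def
  proof (rule runs_Seq[where ?T1.0 = "60 + 20 * n" and
        ?T2.0 = "8 + (n + 1) * (8 + (n + 2) * (300 * (n + 1)\<^sup>2 + 10) + 10)"])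
    show "runs init (ram_input n x Y K) (60 + 20 * n) (\<lambda>s. runs (For ''i'' 0 (IAdd (IReg ''n'') (INum 1))
        (For ''j'' 0 (IAdd (IReg ''n'') (INum 2)) try_cand)) s
        (8 + (n + 1) * (8 + (n + 2) * (300 * (n + 1)\<^sup>2 + 10) + 10))
        (\<lambda>s. \<forall>m\<in>{1..n}. cell s ''U'' m = best n x Y K ({..n} \<times> {..n + 1}) (x m)))"
    proof (rule runs_conseq[OF runs_init[OF n] order_refl], rule runs_For[where J = "\<lambda>p. I (R p)"
          and hi = "n + 1" and B = "8 + (n + 2) * (300 * (n + 1)\<^sup>2 + 10)"])
      fix s assume s: "ram_ready n x Y K s \<and> (\<forall>m\<in>{1..n}. cell s ''U'' m = - \<infinity>)"
      have "R 0 = {}" by (simp add: R_def)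
      then have "I (R 0) s" using s by (simp add: I_def best_empty)
      then show "I (R 0) (s\<lparr>reg := (reg s)(''i'' := 0)\<rparr>)" by (simp add: I_reg)
    next
      fix p s assume "p < n + 1" "reg s ''i'' = p" "I (R p) s"
      from row[OF this] show "runs (For ''j'' 0 (IAdd (IReg ''n'') (INum 2)) try_cand) s
          (8 + (n + 2) * (300 * (n + 1)\<^sup>2 + 10))
          (\<lambda>s'. reg s' ''i'' = p \<and> I (R (Suc p)) (s'\<lparr>reg := (reg s')(''i'' := Suc p)\<rparr>))"
        by (simp add: I_reg)
    next
      fix s assume "I (R (n + 1)) s"
      then show "\<forall>m\<in>{1..n}. cell s ''U'' m = best n x Y K ({..n} \<times> {..n + 1}) (x m)"
        unfolding all by (simp add: I_def)
    qed (use bound in auto)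
    show "60 + 20 * n + (8 + (n + 1) * (8 + (n + 2) * (300 * (n + 1)\<^sup>2 + 10) + 10)) \<le> 1000 * (n + 2) ^ 4"
      by (simp add: power2_eq_square power4_eq_xxxx algebra_simps)
  qed
qed

theorem mainTheorem3:
  "\<exists>(P :: com) (time :: nat \<Rightarrow> nat).
     (\<lambda>n. real (time n)) \<in> O(\<lambda>n. real n ^ 4) \<and>
     (\<forall>(n :: nat) (x :: nat \<Rightarrow> real) (Y :: nat \<Rightarrow> real) (\<alpha> :: real).
        n \<ge> 1 \<and> mono_on {1..n} x \<and> 0 < \<alpha> \<and> \<alpha> < 1 \<longrightarrow>
        (\<exists>t s. exec P (ram_input n x Y (kappa n \<alpha>)) t s \<and> t \<le> time n \<and>
               (\<forall>i\<in>{1..n}. cell s ''U'' i = U_hat n x Y (kappa n \<alpha>) (x i))))"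
proof (rule exI[of _ band_program], rule exI[of _ "\<lambda>n. 1000 * (n + 2) ^ 4"], intro conjI allI impI)
  show "(\<lambda>n. real (1000 * (n + 2) ^ 4)) \<in> O(\<lambda>n. real n ^ 4)"
  proof (rule bigoI)
    show "\<forall>\<^sub>F n in sequentially. norm (real (1000 * (n + 2) ^ 4)) \<le> 1000 * 3 ^ 4 * norm (real n ^ 4)"
      using eventually_ge_at_top[of 1]
    proof eventually_elim
      case (elim n)
      then have "real (n + 2) ^ 4 \<le> (3 * real n) ^ 4" by (intro power_mono) auto
      then show ?case by (simp add: power_mult_distrib)
    qed
  qed
next
  fix n :: nat and x Y :: "nat \<Rightarrow> real" and \<alpha> :: real
  assume "n \<ge> 1 \<and> mono_on {1..n} x \<and> 0 < \<alpha> \<and> \<alpha> < 1"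
  then have n: "n \<ge> 1" and mono: "mono_on {1..n} x" by auto
  show "\<exists>t s. exec band_program (ram_input n x Y (kappa n \<alpha>)) t s \<and> t \<le> 1000 * (n + 2) ^ 4 \<and>
               (\<forall>i\<in>{1..n}. cell s ''U'' i = U_hat n x Y (kappa n \<alpha>) (x i))"
    using runs_band_program[OF n, of x Y "kappa n \<alpha>"] U_hat_eq_best[OF n mono]
    unfolding runs_def by metis
qed

end
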